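(* Let $W\subset\mathbb{R}^n$ be an $n$-dimensional convex polytope having an inscribed sphere. If the center of this sphere coincides with the center of mass of $\partial W$, then $W$ is of Jensen-type, i.e. for every convex function $f\colon W\to\mathbb{R}$, $$\frac{1}{|W|}\int_W f(x)\,dx \le \frac{1}{|\partial W|}\int_{\partial W} f(x)\,dx .$$
   Context: A convex polytope is the convex hull of finitely many points; it is $n$-dimensional if it has nonempty interior in $\mathbb{R}^n$. An inscribed sphere of $W$ is a sphere (contained in $W$) which is tangent to all facets of $W$. $|W|$ is the $n$-dimensional Lebesgue measure of $W$, $|\partial W|$ the $(n-1)$-dimensional (surface/Hausdorff) measure of the boundary $\partial W$; integrals are with respect to these measures. The center of mass of $\partial W$ is $\frac{1}{|\partial W|}\int_{\partial W} x\,dx\in\mathbb{R}^n$. A convex closed shape $X$ is called of Jensen-type if $\frac{1}{|X|}\int_X f\,dx\le\frac{1}{|\partial X|}\int_{\partial X} f\,dx$ for every convex function $f\colon X\to\mathbb{R}$. *)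

theory Defs
  imports "HOL-Analysis.Analysis"
begin

section \<open>Hausdorff measure\<close>

text \<open>
  The constant \<open>unit_ball_vol d\<close> is the volume of the unit ball of dimension \<open>d\<close>, so that the
  \<open>d\<close>-dimensional Hausdorff measure restricts to Lebesgue measure on \<open>d\<close>-dimensional affine
  subspaces.  The empty set is treated separately because \<open>0 ^ 0 = 1\<close>; thus the 0-dimensional
  measure is the counting measure.
\<close>

definition hausdorff_weight :: "nat \<Rightarrow> 'a::metric_space set \<Rightarrow> ennreal" where
  "hausdorff_weight d U =
     (if U = {} then 0 else ennreal (unit_ball_vol (real d) * (diameter U / 2) ^ d))"

text \<open>Boundedness is required because \<open>diameter\<close> is meaningless on unbounded sets.\<close>

definition hausdorff_content :: "nat \<Rightarrow> real \<Rightarrow> 'a::metric_space set \<Rightarrow> ennreal" where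
  "hausdorff_content d \<delta> A =
     (INF U \<in> {U :: nat \<Rightarrow> 'a set. A \<subseteq> (\<Union>i. U i) \<and> (\<forall>i. bounded (U i) \<and> diameter (U i) \<le> \<delta>)}.
        \<Sum>i. hausdorff_weight d (U i))"

definition hausdorff_outer :: "nat \<Rightarrow> 'a::metric_space set \<Rightarrow> ennreal" where
  "hausdorff_outer d A = (SUP \<delta> \<in> {0<..}. hausdorff_content d \<delta> A)"

text \<open>
  The generic constructor \<open>measure_of\<close> yields the zero measure unless the given set function is
  countably additive; that this is the case here is the lemma
  \<open>emeasure_hausdorff_measure\<close> below.
\<close>

definition hausdorff_measure :: "nat \<Rightarrow> 'a::metric_space measure" where
  "hausdorff_measure d = measure_of UNIV (sets borel) (hausdorff_outer d)"

lemma space_hausdorff_measure [simp]: "space (hausdorff_measure d) = UNIV"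
  by (simp add: hausdorff_measure_def space_measure_of_conv)

lemma sets_hausdorff_measure [simp, measurable_cong]: "sets (hausdorff_measure d) = sets borel"
  unfolding hausdorff_measure_def
  by (metis sets.sets_measure_of_eq space_borel)

lemma hausdorff_weight_empty [simp]: "hausdorff_weight d {} = 0"
  by (simp add: hausdorff_weight_def)

lemma hausdorff_content_le:
  assumes "A \<subseteq> (\<Union>i. U i)" "\<And>i. bounded (U i)" "\<And>i. diameter (U i) \<le> \<delta>"
  shows "hausdorff_content d \<delta> A \<le> (\<Sum>i. hausdorff_weight d (U i))"
  unfolding hausdorff_content_def using assms by (intro INF_lower) auto

lemma hausdorff_content_mono: "A \<subseteq> B \<Longrightarrow> hausdorff_content d \<delta> A \<le> hausdorff_content d \<delta> B"
  unfolding hausdorff_content_def by (intro INF_superset_mono) auto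

lemma hausdorff_content_antimono:
  "\<delta> \<le> \<epsilon> \<Longrightarrow> hausdorff_content d \<epsilon> A \<le> hausdorff_content d \<delta> A"
  unfolding hausdorff_content_def by (intro INF_superset_mono) (auto intro: order_trans)

lemma hausdorff_content_empty:
  assumes "\<delta> > 0" shows "hausdorff_content d \<delta> {} = 0"
  using hausdorff_content_le[of "{}" "\<lambda>_. {}" \<delta> d] assms by simp

lemma hausdorff_content_UN:
  "hausdorff_content d \<delta> (\<Union>i. A i) \<le> (\<Sum>i. hausdorff_content d \<delta> (A i))"
proof (rule ennreal_le_epsilon)
  fix e :: real
  assume e: "0 < e" and fin: "(\<Sum>n. hausdorff_content d \<delta> (A n)) < top"
  then have lt: "hausdorff_content d \<delta> (A n) < hausdorff_content d \<delta> (A n) + e * (1/2)^Suc n" for n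
    by (auto simp add: less_top dest!: ennreal_suminf_lessD)
  have "\<exists>U. A n \<subseteq> (\<Union>i. U i) \<and> (\<forall>i. bounded (U i) \<and> diameter (U i) \<le> \<delta>) \<and>
      (\<Sum>i. hausdorff_weight d (U i)) \<le> hausdorff_content d \<delta> (A n) + e * (1/2)^Suc n" for n
    using lt[of n] unfolding hausdorff_content_def[of d \<delta> "A n"] INF_less_iff
    by (auto intro: less_imp_le)
  then obtain B where B: "\<And>n. A n \<subseteq> (\<Union>i. B n i)"
      "\<And>n i. bounded (B n i)" "\<And>n i. diameter (B n i) \<le> \<delta>"
      "\<And>n. (\<Sum>i. hausdorff_weight d (B n i)) \<le> hausdorff_content d \<delta> (A n) + e * (1/2)^Suc n"
    by metis
  define C where "C = case_prod B \<circ> prod_decode"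
  have cov: "(\<Union>i. A i) \<subseteq> (\<Union>i. C i)"
    using B(1) by (auto simp add: C_def subset_eq) (metis prod.case prod_encode_inverse)
  have "hausdorff_content d \<delta> (\<Union>i. A i) \<le> (\<Sum>i. hausdorff_weight d (C i))"
    using B(2,3) by (intro hausdorff_content_le cov) (auto simp: C_def split_def)
  also have "\<dots> = (\<Sum>n. \<Sum>i. hausdorff_weight d (B n i))"
    unfolding C_def comp_def by (intro suminf_ennreal_2dimen) auto
  also have "\<dots> \<le> (\<Sum>n. hausdorff_content d \<delta> (A n) + e * (1/2) ^ Suc n)"
    by (intro suminf_le allI B(4)) auto
  also have "\<dots> = (\<Sum>n. hausdorff_content d \<delta> (A n)) + (\<Sum>n. ennreal e * ennreal ((1/2) ^ Suc n))"
    using \<open>0 < e\<close> by (subst suminf_add[symmetric])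
      (auto simp del: ennreal_suminf_cmult simp add: ennreal_mult[symmetric])
  also have "\<dots> = (\<Sum>n. hausdorff_content d \<delta> (A n)) + e"
    unfolding ennreal_suminf_cmult
    by (subst suminf_ennreal_eq[OF zero_le_power power_half_series]) auto
  finally show "hausdorff_content d \<delta> (\<Union>i. A i) \<le> (\<Sum>n. hausdorff_content d \<delta> (A n)) + e" .
qed

lemma hausdorff_outer_mono: "A \<subseteq> B \<Longrightarrow> hausdorff_outer d A \<le> hausdorff_outer d B"
  unfolding hausdorff_outer_def by (intro SUP_mono) (auto intro: hausdorff_content_mono)

lemma hausdorff_outer_empty [simp]: "hausdorff_outer d {} = 0"
  unfolding hausdorff_outer_def by (auto simp: hausdorff_content_empty image_constant_conv)

lemma hausdorff_content_le_outer: "\<delta> > 0 \<Longrightarrow> hausdorff_content d \<delta> A \<le> hausdorff_outer d A"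
  unfolding hausdorff_outer_def by (intro SUP_upper) auto

lemma hausdorff_outer_UN: "hausdorff_outer d (\<Union>i. A i) \<le> (\<Sum>i. hausdorff_outer d (A i))"
  unfolding hausdorff_outer_def[of d "\<Union>i. A i"]
proof (intro SUP_least)
  fix \<delta> :: real assume "\<delta> \<in> {0<..}"
  then show "hausdorff_content d \<delta> (\<Union>i. A i) \<le> (\<Sum>i. hausdorff_outer d (A i))"
    by (intro order_trans[OF hausdorff_content_UN] suminf_le hausdorff_content_le_outer) auto
qed

lemma hausdorff_outer_Un: "hausdorff_outer d (A \<union> B) \<le> hausdorff_outer d A + hausdorff_outer d B"
proof -
  have "hausdorff_outer d (A \<union> B) = hausdorff_outer d (\<Union>i. case i of 0 \<Rightarrow> A | Suc 0 \<Rightarrow> B | _ \<Rightarrow> {})"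
    by (rule arg_cong[where f = "hausdorff_outer d"]) (auto split: nat.splits)
  also have "\<dots> \<le> (\<Sum>i. hausdorff_outer d (case i of 0 \<Rightarrow> A | Suc 0 \<Rightarrow> B | _ \<Rightarrow> {}))"
    by (rule hausdorff_outer_UN)
  also have "\<dots> = (\<Sum>i\<in>{0, Suc 0}. hausdorff_outer d (case i of 0 \<Rightarrow> A | Suc 0 \<Rightarrow> B | _ \<Rightarrow> {}))"
    by (intro suminf_finite) (auto split: nat.splits)
  finally show ?thesis by simp
qed

lemma outer_measure_space_hausdorff: "outer_measure_space UNIV (hausdorff_outer d)"
  unfolding outer_measure_space_def positive_def increasing_def countably_subadditive_def
  by (auto intro: hausdorff_outer_mono hausdorff_outer_UN)

lemma hausdorff_outer_add_le:
  fixes A B :: "'a::metric_space set"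
  assumes eps: "\<epsilon> > 0" and sep: "\<And>x y. x \<in> A \<Longrightarrow> y \<in> B \<Longrightarrow> \<epsilon> \<le> dist x y"
  shows "hausdorff_outer d A + hausdorff_outer d B \<le> hausdorff_outer d (A \<union> B)"
proof -
  let ?w = "hausdorff_weight d :: 'a set \<Rightarrow> ennreal"
  have small: "hausdorff_content d \<delta> A + hausdorff_content d \<delta> B \<le> hausdorff_content d \<delta> (A \<union> B)"
    if d: "0 < \<delta>" "\<delta> < \<epsilon>" for \<delta>
    unfolding hausdorff_content_def[of d \<delta> "A \<union> B"]
  proof (intro INF_greatest, clarify)
    fix U :: "nat \<Rightarrow> 'a set"
    assume cov: "A \<union> B \<subseteq> (\<Union>i. U i)" and U: "\<forall>i. bounded (U i) \<and> diameter (U i) \<le> \<delta>"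
    define V where "V i = (if U i \<inter> A = {} then {} else U i)" for i
    define W where "W i = (if U i \<inter> A = {} then U i else {})" for i
    have disj: "U i \<inter> B = {}" if "U i \<inter> A \<noteq> {}" for i
    proof (rule ccontr)
      assume "U i \<inter> B \<noteq> {}"
      with that obtain x y where xy: "x \<in> U i" "x \<in> A" "y \<in> U i" "y \<in> B" by blast
      have "dist x y \<le> diameter (U i)"
        using U xy by (intro diameter_bounded_bound) auto
      also have "\<dots> \<le> \<delta>" using U by auto
      finally have "dist x y \<le> \<delta>" .
      then show False using sep[of x y] xy d by auto
    qed
    have "x \<in> (\<Union>i. V i)" if x: "x \<in> A" for x
    proof -
      obtain i where "x \<in> U i" using x cov by blast
      then have "x \<in> V i" using x by (auto simp: V_def)
      then show ?thesis by blast
    qed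
    moreover have "x \<in> (\<Union>i. W i)" if x: "x \<in> B" for x
    proof -
      obtain i where "x \<in> U i" using x cov by blast
      then have "x \<in> W i" using x disj[of i] by (auto simp: W_def)
      then show ?thesis by blast
    qed
    ultimately have "A \<subseteq> (\<Union>i. V i)" "B \<subseteq> (\<Union>i. W i)" by blast+
    then have "hausdorff_content d \<delta> A \<le> (\<Sum>i. ?w (V i))" "hausdorff_content d \<delta> B \<le> (\<Sum>i. ?w (W i))"
      using U d by (intro hausdorff_content_le; simp add: V_def W_def)+
    then have "hausdorff_content d \<delta> A + hausdorff_content d \<delta> B \<le> (\<Sum>i. ?w (V i)) + (\<Sum>i. ?w (W i))"
      by (rule add_mono)
    also have "\<dots> = (\<Sum>i. ?w (V i) + ?w (W i))"
      by (rule suminf_add) auto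
    also have "(\<lambda>i. ?w (V i) + ?w (W i)) = (\<lambda>i. ?w (U i))"
      by (auto simp: V_def W_def)
    finally show "hausdorff_content d \<delta> A + hausdorff_content d \<delta> B \<le> (\<Sum>i. ?w (U i))" .
  qed
  have pair: "hausdorff_content d \<delta> A + hausdorff_content d \<delta>' B \<le> hausdorff_outer d (A \<union> B)"
    if "\<delta> > 0" "\<delta>' > 0" for \<delta> \<delta>'
  proof -
    define \<eta> where "\<eta> = min (min \<delta> \<delta>') (\<epsilon> / 2)"
    have \<eta>: "0 < \<eta>" "\<eta> < \<epsilon>" "\<eta> \<le> \<delta>" "\<eta> \<le> \<delta>'" using that eps by (auto simp: \<eta>_def)
    have "hausdorff_content d \<delta> A + hausdorff_content d \<delta>' B
        \<le> hausdorff_content d \<eta> A + hausdorff_content d \<eta> B"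
      using \<eta> by (intro add_mono hausdorff_content_antimono)
    also have "\<dots> \<le> hausdorff_content d \<eta> (A \<union> B)" using \<eta> by (intro small)
    also have "\<dots> \<le> hausdorff_outer d (A \<union> B)" using \<eta> by (intro hausdorff_content_le_outer)
    finally show ?thesis .
  qed
  have "hausdorff_outer d A + hausdorff_content d \<delta>' B \<le> hausdorff_outer d (A \<union> B)" if "\<delta>' > 0" for \<delta>'
    unfolding hausdorff_outer_def[of d A]
    using that by (subst ennreal_SUP_add_left[symmetric]) (auto intro!: SUP_least pair)
  then show ?thesis
    unfolding hausdorff_outer_def[of d B]
    by (subst add.commute, subst ennreal_SUP_add_left[symmetric])
      (auto intro!: SUP_least simp: add.commute)
qed

lemma hausdorff_outer_sum_le:
  fixes R :: "nat \<Rightarrow> 'a::metric_space set"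
  assumes "\<And>i j. i < j \<Longrightarrow> \<exists>\<epsilon>>0. \<forall>x\<in>R i. \<forall>y\<in>R j. \<epsilon> \<le> dist x y"
  shows "(\<Sum>i<n. hausdorff_outer d (R i)) \<le> hausdorff_outer d (\<Union>i<n. R i)"
proof (induction n)
  case (Suc n)
  obtain e where e: "\<And>i. i < n \<Longrightarrow> e i > 0 \<and> (\<forall>x\<in>R i. \<forall>y\<in>R n. e i \<le> dist x y)"
    using assms[of _ n] by metis
  define \<epsilon> where "\<epsilon> = Min (insert 1 (e ` {..<n}))"
  have "\<epsilon> > 0" using e by (auto simp: \<epsilon>_def)
  moreover have "\<epsilon> \<le> dist x y" if "x \<in> (\<Union>i<n. R i)" "y \<in> R n" for x y
  proof -
    from that obtain i where i: "i < n" "x \<in> R i" by auto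
    have "\<epsilon> \<le> e i" using i by (auto simp: \<epsilon>_def)
    also have "\<dots> \<le> dist x y" using e i that by auto
    finally show ?thesis .
  qed
  ultimately have "hausdorff_outer d (\<Union>i<n. R i) + hausdorff_outer d (R n)
      \<le> hausdorff_outer d ((\<Union>i<n. R i) \<union> R n)"
    by (intro hausdorff_outer_add_le[where \<epsilon> = \<epsilon>]) auto
  also have "(\<Union>i<n. R i) \<union> R n = (\<Union>i<Suc n. R i)"
    by (auto simp: less_Suc_eq)
  finally have "hausdorff_outer d (\<Union>i<n. R i) + hausdorff_outer d (R n)
      \<le> hausdorff_outer d (\<Union>i<Suc n. R i)" .
  from order_trans[OF add_right_mono[OF Suc.IH] this] show ?case
    by (simp only: sum.lessThan_Suc)
qed simp

lemma closed_in_lambda_system_hausdorff: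
  fixes C :: "'a::metric_space set"
  assumes "closed C"
  shows "C \<in> lambda_system UNIV UNIV (hausdorff_outer d)"
proof (cases "C = {}")
  case True
  then show ?thesis by (simp add: lambda_system_def)
next
  case ne: False
  let ?H = "hausdorff_outer d :: 'a set \<Rightarrow> ennreal"
  have key: "?H (X \<inter> C) + ?H (X - C) \<le> ?H X" if fin: "?H X < top" for X
  proof -
    define S where "S n = {x \<in> X. 1 / real (Suc n) \<le> infdist x C}" for n
    define R where "R n = S (Suc n) - S n" for n
    have S_mono: "S m \<subseteq> S n" if "m \<le> n" for m n
    proof -
      have "1 / real (Suc n) \<le> 1 / real (Suc m)" using that by (simp add: frac_le)
      then show ?thesis by (auto simp: S_def)
    qed
    have SX: "S n \<subseteq> X" for n by (auto simp: S_def)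
    have RX: "R n \<subseteq> X" for n using SX by (auto simp: R_def)
    have sepR: "\<exists>\<epsilon>>0. \<forall>x\<in>R i. \<forall>y\<in>R j. \<epsilon> \<le> dist x y" if "i + 2 \<le> j" for i j
    proof (intro exI conjI ballI)
      show "1 / real (Suc (Suc i)) - 1 / real (Suc j) > 0"
        using that by (simp add: divide_strict_left_mono)
      fix x y assume "x \<in> R i" "y \<in> R j"
      then have x: "1 / real (Suc (Suc i)) \<le> infdist x C" and y: "infdist y C < 1 / real (Suc j)"
        by (auto simp: R_def S_def)
      have "infdist x C \<le> infdist y C + dist x y" by (rule infdist_triangle)
      then show "1 / real (Suc (Suc i)) - 1 / real (Suc j) \<le> dist x y" using x y by linarith
    qed
    have bound: "(\<Sum>i. ?H (R (2 * i + k))) \<le> ?H X" for k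
    proof (intro suminf_le_const[OF summableI])
      fix n
      have "(\<Sum>i<n. ?H (R (2 * i + k))) \<le> ?H (\<Union>i<n. R (2 * i + k))"
        by (intro hausdorff_outer_sum_le sepR) auto
      also have "\<dots> \<le> ?H X" using RX by (intro hausdorff_outer_mono) auto
      finally show "(\<Sum>i<n. ?H (R (2 * i + k))) \<le> ?H X" .
    qed
    have sumfin: "(\<Sum>i. ?H (R i)) < top"
    proof -
      have "(\<Sum>i. ?H (R i)) \<le> ?H X + ?H X"
      proof (intro suminf_le_const[OF summableI])
        fix n
        have "(\<Sum>i<n. ?H (R i)) \<le> (\<Sum>i<2*n. ?H (R i))"
          by (intro sum_mono2) auto
        also have "\<dots> = (\<Sum>i<n. ?H (R (2 * i))) + (\<Sum>i<n. ?H (R (2 * i + 1)))"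
          by (induction n) (auto simp: algebra_simps)
        also have "\<dots> \<le> (\<Sum>i. ?H (R (2 * i + 0))) + (\<Sum>i. ?H (R (2 * i + 1)))"
          by (intro add_mono) (simp_all add: sum_le_suminf)
        also have "\<dots> \<le> ?H X + ?H X" by (intro add_mono bound)
        finally show "(\<Sum>i<n. ?H (R i)) \<le> ?H X + ?H X" .
      qed
      also have "\<dots> < top" using fin by (simp add: ennreal_add_less_top)
      finally show ?thesis .
    qed
    have tail: "(\<lambda>n. \<Sum>i. ?H (R (i + n))) \<longlonglongrightarrow> 0"
    proof -
      define r where "r i = enn2real (?H (R i))" for i
      have Hr: "?H (R i) = ennreal (r i)" for i
      proof -
        have "?H (R i) \<le> ?H X" using RX by (intro hausdorff_outer_mono)
        then show ?thesis using fin by (simp add: r_def ennreal_enn2real_if top_unique less_top)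
      qed
      have r0: "r i \<ge> 0" for i by (simp add: r_def)
      have "summable r"
        using sumfin r0 by (intro summable_suminf_not_top) (auto simp: Hr)
      then have "(\<lambda>n. \<Sum>i. r (i + n)) \<longlonglongrightarrow> 0" by (rule suminf_exist_split2)
      then have "(\<lambda>n. ennreal (\<Sum>i. r (i + n))) \<longlonglongrightarrow> ennreal 0" by (rule tendsto_ennrealI)
      moreover have "ennreal (\<Sum>i. r (i + n)) = (\<Sum>i. ?H (R (i + n)))" for n
        using r0 \<open>summable r\<close> unfolding Hr
        by (intro suminf_ennreal2[symmetric]) (auto simp: summable_iff_shift)
      ultimately show ?thesis by simp
    qed
    have XC: "X - C \<subseteq> S n \<union> (\<Union>i. R (i + n))" for n
    proof
      fix x assume x: "x \<in> X - C"
      then have "infdist x C > 0"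
        using assms ne by (simp add: infdist_pos_not_in_closed)
      then obtain m where m: "1 / real (Suc m) \<le> infdist x C"
        by (metis inverse_eq_divide less_imp_le reals_Archimedean)
      define p where "p = (LEAST m. x \<in> S m)"
      have "x \<in> S m" using m x by (auto simp: S_def)
      then have p: "x \<in> S p" unfolding p_def by (rule LeastI)
      show "x \<in> S n \<union> (\<Union>i. R (i + n))"
      proof (cases "p \<le> n")
        case True
        then show ?thesis using S_mono[of p n] p by auto
      next
        case False
        then obtain q where q: "p = Suc (q + n)"
          by (metis add.commute less_imp_Suc_add not_le)
        then have "x \<notin> S (q + n)" using not_less_Least[of "q + n" "\<lambda>m. x \<in> S m"] p_def by auto
        then show ?thesis using p q by (auto simp: R_def)
      qed
    qed
    have "?H (X \<inter> C) + ?H (X - C) \<le> ?H X + (\<Sum>i. ?H (R (i + n)))" for n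
    proof -
      have "?H (X - C) \<le> ?H (S n \<union> (\<Union>i. R (i + n)))"
        by (intro hausdorff_outer_mono XC)
      also have "\<dots> \<le> ?H (S n) + ?H (\<Union>i. R (i + n))" by (rule hausdorff_outer_Un)
      also have "\<dots> \<le> ?H (S n) + (\<Sum>i. ?H (R (i + n)))"
        by (intro add_left_mono hausdorff_outer_UN)
      finally have "?H (X \<inter> C) + ?H (X - C) \<le> ?H (X \<inter> C) + ?H (S n) + (\<Sum>i. ?H (R (i + n)))"
        by (simp add: add_left_mono add.assoc)
      also have "?H (X \<inter> C) + ?H (S n) \<le> ?H (X \<inter> C \<union> S n)"
      proof (rule hausdorff_outer_add_le[where \<epsilon> = "1 / real (Suc n)"])
        fix x y assume "x \<in> X \<inter> C" "y \<in> S n"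
        then show "1 / real (Suc n) \<le> dist x y"
          using infdist_le[of x C y] by (auto simp: S_def dist_commute)
      qed simp
      also have "?H (X \<inter> C \<union> S n) \<le> ?H X" using SX by (intro hausdorff_outer_mono) auto
      finally show ?thesis by (simp add: add_right_mono)
    qed
    moreover have "(\<lambda>n. ?H X + (\<Sum>i. ?H (R (i + n)))) \<longlonglongrightarrow> ?H X + 0"
      by (intro tendsto_add tail tendsto_const)
    ultimately show ?thesis
      by (metis (no_types, lifting) LIMSEQ_le_const add.right_neutral)
  qed
  have "?H (X \<inter> C) + ?H (X - C) = ?H X" for X
  proof (rule antisym)
    show "?H (X \<inter> C) + ?H (X - C) \<le> ?H X"
      by (cases "?H X = top") (simp, metis key less_top)
    show "?H X \<le> ?H (X \<inter> C) + ?H (X - C)"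
      using hausdorff_outer_Un[of d "X \<inter> C" "X - C"] by (simp add: Int_Diff_Un)
  qed
  then show ?thesis
    unfolding lambda_system_def by (auto simp: Int_commute Diff_eq)
qed

lemma emeasure_hausdorff_measure:
  assumes "A \<in> sets borel"
  shows "emeasure (hausdorff_measure d) A = hausdorff_outer d A"
proof -
  let ?L = "lambda_system UNIV UNIV (hausdorff_outer d :: 'a set \<Rightarrow> ennreal)"
  have ms: "measure_space UNIV ?L (hausdorff_outer d)"
    using sigma_algebra.caratheodory_lemma[OF sigma_algebra_Pow, of UNIV "hausdorff_outer d"]
      outer_measure_space_hausdorff[of d] by simp
  then have "sigma_algebra UNIV ?L" by (simp add: measure_space_def)
  then have "sigma_sets UNIV (Collect closed) \<subseteq> ?L"
    by (intro sigma_algebra.sigma_sets_subset) (auto intro: closed_in_lambda_system_hausdorff)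
  moreover have sb: "sets (borel :: 'a measure) = sigma_sets UNIV (Collect closed)"
    unfolding borel_eq_closed by simp
  ultimately have sub: "sets (borel :: 'a measure) \<subseteq> ?L" by simp
  show ?thesis
  proof (rule emeasure_measure_of[OF hausdorff_measure_def])
    show "positive (sets (hausdorff_measure d)) (hausdorff_outer d :: 'a set \<Rightarrow> ennreal)"
      by (simp add: positive_def)
    show "countably_additive (sets (hausdorff_measure d)) (hausdorff_outer d :: 'a set \<Rightarrow> ennreal)"
      using ms sub unfolding measure_space_def countably_additive_def by (simp add: subset_iff)
  qed (use assms in auto)
qed


section \<open>Inscribed spheres and Jensen-type shapes\<close>

abbreviation surface_measure :: "'a::euclidean_space measure" where
  "surface_measure \<equiv> hausdorff_measure (DIM('a) - 1)"

definition boundary_center_of_mass :: "'a::euclidean_space set \<Rightarrow> 'a" where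
  "boundary_center_of_mass W =
     (1 / measure surface_measure (frontier W)) *\<^sub>R (LINT x:frontier W|surface_measure. x)"

text \<open>
  A sphere is tangent to a facet \<open>F\<close> if it meets \<open>F\<close> in a point \<open>p\<close> at which the hyperplane
  spanned by \<open>F\<close> is the tangent hyperplane of the sphere.
\<close>

definition sphere_tangent_to :: "'a::euclidean_space \<Rightarrow> real \<Rightarrow> 'a set \<Rightarrow> bool" where
  "sphere_tangent_to c r F \<longleftrightarrow>
     (\<exists>p \<in> F \<inter> sphere c r. affine hull F = {x. (p - c) \<bullet> (x - p) = 0})"

definition inscribed_sphere :: "'a::euclidean_space \<Rightarrow> real \<Rightarrow> 'a set \<Rightarrow> bool" where
  "inscribed_sphere c r W \<longleftrightarrow>
     r > 0 \<and> sphere c r \<subseteq> W \<and> (\<forall>F. F facet_of W \<longrightarrow> sphere_tangent_to c r F)"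

text \<open>
  Every convex function on a full-dimensional polytope \<open>W\<close> is bounded, and it is continuous on the
  relative interior of each face of \<open>W\<close>, hence Borel measurable on \<open>W\<close>.  Both integrals below
  therefore exist in that case, without any regularity assumption on \<open>f\<close>.
\<close>

definition jensen_type :: "'a::euclidean_space set \<Rightarrow> bool" where
  "jensen_type X \<longleftrightarrow> convex X \<and> closed X \<and>
     (\<forall>f :: 'a \<Rightarrow> real. convex_on X f \<longrightarrow>
        (1 / measure lebesgue X) * (LINT x:X|lebesgue. f x)
          \<le> (1 / measure surface_measure (frontier X)) * (LINT x:frontier X|surface_measure. f x))"

end

theory Submission
  imports Defs
begin

text \<open>
  Let \<open>g\<close> be the gauge of \<open>W\<close> with respect to \<open>c\<close>, and let \<open>\<phi>\<close> be the radial projection from \<open>c\<close> onto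
  the boundary.  All facets have the same distance from \<open>c\<close>, so \<open>\<phi>\<close> maps the uniform distribution on
  \<open>W\<close> to the uniform distribution on the boundary; by homogeneity, \<open>g\<close> and \<open>\<phi>\<close> are independent under
  the former.  Averaging \<open>f x \<le> g x * f (\<phi> x) + (1 - g x) * f c\<close> over \<open>W\<close> therefore bounds the average of
  \<open>f\<close> by a convex combination of its boundary average and \<open>f c\<close>, and \<open>f c\<close> is at most the boundary
  average by Jensen's inequality, as \<open>c\<close> is the center of mass of the boundary.

  That Hausdorff measure on a hyperplane is proportional to the volume of the cone with fixed apex
  follows from the uniqueness of translation-invariant measures.  The value of the constant cancels,
  so the isodiametric inequality is not needed; it only has to be positive, finite and the same for
  all facets.
\<close>

section \<open>Uniqueness of translation-invariant measures\<close>

text \<open>Cone volume is a translation-invariant function of the base because a translation of the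
  base within its hyperplane lifts to a shear of the cone, and shears preserve volume. A cone of
  height \<open>r\<close> over a base of area \<open>a\<close> has volume \<open>r * a / n\<close>
  with \<open>n = DIM('a)\<close>, so the proportionality constant depends on the height; this is
  where equal distance of the facets from \<open>c\<close> enters. The independence has a concrete
  cause: the homothety about \<open>c\<close> with factor \<open>t\<close> maps the part of
  \<open>W\<close> over a boundary set \<open>A\<close> onto its points with
  \<open>g \<le> t\<close>. Hence a fraction \<open>t ^ n\<close> of that part has
  \<open>g \<le> t\<close>, whatever \<open>A\<close> is. The mean of \<open>g\<close> is therefore
  \<open>n / (n + 1)\<close>; it enters only as a number \<open>\<gamma>\<close> between 0 and 1. A
  convex function may jump at the boundary of \<open>W\<close>, so boundary integrals are not limits
  of integrals over the interior. All comparisons are therefore made between measures, by pushing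
  forward along \<open>\<phi>\<close>.\<close>

lemma sigma_finite_measure_cball:
  fixes M :: "'a::euclidean_space measure"
  assumes sets: "sets M = sets borel"
    and fin: "\<And>n::nat. emeasure M (cball 0 (real n)) < \<infinity>"
  shows "sigma_finite_measure M"
proof
  have sp: "space M = UNIV"
    using sets_eq_imp_space_eq[OF sets] by simp
  let ?A = "range (\<lambda>n::nat. cball (0::'a) (real n))"
  have "\<exists>n::nat. norm x \<le> real n" for x :: 'a
    by (rule real_arch_simple)
  then have "\<Union> ?A = UNIV" by auto
  then show "\<exists>A. countable A \<and> A \<subseteq> sets M \<and> \<Union> A = space M \<and> (\<forall>a\<in>A. emeasure M a \<noteq> \<infinity>)"
    using fin by (intro exI[of _ ?A]) (auto simp: sets sp less_top)
qed

text \<open>Both sides compute the product measure of the set of pairs with \<open>x \<in> A\<close> and \<open>y - x \<in> B\<close>.\<close>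

lemma emeasure_translation_invariant_mult_commute:
  fixes M N :: "'a::euclidean_space measure"
  assumes sM: "sets M = sets borel" and sN: "sets N = sets borel"
    and S: "subspace S" and SM: "emeasure M (- S) = 0" and SN: "emeasure N (- S) = 0"
    and invM: "\<And>x A. x \<in> S \<Longrightarrow> A \<in> sets borel \<Longrightarrow> emeasure M ((+) x -` A) = emeasure M A"
    and invN: "\<And>x A. x \<in> S \<Longrightarrow> A \<in> sets borel \<Longrightarrow> emeasure N ((+) x -` A) = emeasure N A"
    and finM: "\<And>n::nat. emeasure M (cball 0 (real n)) < \<infinity>"
    and finN: "\<And>n::nat. emeasure N (cball 0 (real n)) < \<infinity>"
    and A: "A \<in> sets borel" and B: "B \<in> sets borel" and sym: "uminus -` B = B"
  shows "emeasure M A * emeasure N B = emeasure N A * emeasure M B"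
proof -
  interpret M: sigma_finite_measure M by (rule sigma_finite_measure_cball[OF sM finM])
  interpret N: sigma_finite_measure N by (rule sigma_finite_measure_cball[OF sN finN])
  interpret MN: pair_sigma_finite M N ..
  note [measurable_cong] = sM sN
  note [measurable] = A B
  have sp: "space M = UNIV" "space N = UNIV"
    using sets_eq_imp_space_eq[OF sM] sets_eq_imp_space_eq[OF sN] by simp_all
  have Sb: "- S \<in> sets borel"
    using closed_subspace[OF S] by (simp add: borel_open open_Compl)
  \<comment> \<open>Invariance is available only for vectors of \<open>S\<close>. Both measures are
    concentrated on \<open>S\<close>, so almost every slice below can still be translated.\<close>
  have AEM: "AE x in M. x \<in> S"
    using SM Sb by (intro AE_I[of _ _ "- S"]) (auto simp: sM)
  have AEN: "AE x in N. x \<in> S"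
    using SN Sb by (intro AE_I[of _ _ "- S"]) (auto simp: sN)
  have Bneg: "- x \<in> B \<longleftrightarrow> x \<in> B" for x using sym by auto
  define E where "E = {p. fst p \<in> A \<and> snd p - fst p \<in> B}"
  \<comment> \<open>\<open>F\<close> is \<open>E\<close> with \<open>x\<close> replaced by
    \<open>x + y\<close>: then \<open>y - (x + y) = - x\<close>, and the symmetry of
    \<open>B\<close> removes the sign. Invariance of \<open>M\<close> thus exchanges the slices of
    \<open>E\<close> and \<open>F\<close> over a fixed \<open>y\<close>.\<close>
  define F where "F = {p. fst p + snd p \<in> A \<and> fst p \<in> B}"
  have E: "E \<in> sets (M \<Otimes>\<^sub>M N)"
  proof -
    have "{p \<in> space (M \<Otimes>\<^sub>M N). fst p \<in> A \<and> snd p - fst p \<in> B} \<in> sets (M \<Otimes>\<^sub>M N)"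
      by measurable
    then show ?thesis by (simp add: E_def space_pair_measure sp)
  qed
  have F: "F \<in> sets (M \<Otimes>\<^sub>M N)"
  proof -
    have "{p \<in> space (M \<Otimes>\<^sub>M N). fst p + snd p \<in> A \<and> fst p \<in> B} \<in> sets (M \<Otimes>\<^sub>M N)"
      by measurable
    then show ?thesis by (simp add: F_def space_pair_measure sp)
  qed
  have "emeasure M A * emeasure N B = (\<integral>\<^sup>+x. emeasure N B * indicator A x \<partial>M)"
    using A by (subst nn_integral_cmult_indicator) (auto simp: sM mult.commute)
  also have "\<dots> = (\<integral>\<^sup>+x. emeasure N (Pair x -` E) \<partial>M)"
  proof (rule nn_integral_cong_AE, use AEM in eventually_elim)
    fix x assume x: "x \<in> S"
    have "Pair x -` E = (if x \<in> A then (+) (- x) -` B else {})"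
      by (auto simp: E_def)
    then show "emeasure N B * indicator A x = emeasure N (Pair x -` E)"
      using invN[of "- x" B] x S B by (auto simp: subspace_neg)
  qed
  also have "\<dots> = emeasure (M \<Otimes>\<^sub>M N) E"
    by (rule N.emeasure_pair_measure_alt[OF E, symmetric])
  also have "\<dots> = (\<integral>\<^sup>+y. emeasure M ((\<lambda>x. (x, y)) -` E) \<partial>N)"
    by (rule MN.emeasure_pair_measure_alt2[OF E])
  also have "\<dots> = (\<integral>\<^sup>+y. emeasure M ((\<lambda>x. (x, y)) -` F) \<partial>N)"
  proof (rule nn_integral_cong_AE, use AEN in eventually_elim)
    fix y assume y: "y \<in> S"
    have "(\<lambda>x. (x, y)) -` E \<in> sets M" using E by (rule sets_Pair2)
    moreover have "(+) y -` ((\<lambda>x. (x, y)) -` E) = (\<lambda>x. (x, y)) -` F"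
      using Bneg by (auto simp: E_def F_def add.commute)
    ultimately show "emeasure M ((\<lambda>x. (x, y)) -` E) = emeasure M ((\<lambda>x. (x, y)) -` F)"
      using invM[of y "(\<lambda>x. (x, y)) -` E"] y by (simp add: sM)
  qed
  also have "\<dots> = emeasure (M \<Otimes>\<^sub>M N) F"
    by (rule MN.emeasure_pair_measure_alt2[OF F, symmetric])
  also have "\<dots> = (\<integral>\<^sup>+x. emeasure N (Pair x -` F) \<partial>M)"
    by (rule N.emeasure_pair_measure_alt[OF F])
  also have "\<dots> = (\<integral>\<^sup>+x. emeasure N A * indicator B x \<partial>M)"
  proof (rule nn_integral_cong_AE, use AEM in eventually_elim)
    fix x assume x: "x \<in> S"
    have "Pair x -` F = (if x \<in> B then (+) x -` A else {})"
      by (auto simp: F_def)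
    then show "emeasure N (Pair x -` F) = emeasure N A * indicator B x"
      using invN[of x A] x A by auto
  qed
  also have "\<dots> = emeasure N A * emeasure M B"
    using B by (subst nn_integral_cmult_indicator) (auto simp: sM)
  finally show ?thesis .
qed

section \<open>Lebesgue measure under invertible linear maps, reflections and shears\<close>

lemma emeasure_lborel_vimage_plus:
  fixes x :: "'a::euclidean_space"
  assumes [measurable]: "A \<in> sets borel"
  shows "emeasure lborel ((+) x -` A) = emeasure lborel A"
proof -
  have "emeasure lborel A = emeasure (distr lborel borel ((+) x)) A"
    by (simp add: lborel_distr_plus)
  also have "\<dots> = emeasure lborel ((+) x -` A)"
    by (subst emeasure_distr) auto
  finally show ?thesis by simp
qed

text \<open>The pushforward of Lebesgue measure under \<open>f\<close> is again translation
  invariant, so it is a multiple of Lebesgue measure. The factor, the determinant of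
  \<open>g\<close> up to sign, is recorded through its effect on one reference set
  \<open>B\<close>.\<close>

lemma emeasure_lborel_vimage_linear:
  fixes f g :: "'a::euclidean_space \<Rightarrow> 'a"
  assumes f: "linear f" and g: "linear g" and fg: "\<And>x. f (g x) = x"
    and A: "A \<in> sets borel"
    and B: "B \<in> sets borel" "uminus -` B = B"
  shows "emeasure lborel (f -` A) * emeasure lborel B = emeasure lborel A * emeasure lborel (f -` B)"
proof -
  have [measurable]: "f \<in> borel_measurable borel" "g \<in> borel_measurable borel"
    using f g by (auto intro!: borel_measurable_continuous_onI linear_continuous_on simp: linear_conv_bounded_linear)
  have "f \<circ> g = id" using fg by auto
  then have gf: "g (f x) = x" for x
    using linear_inverse_left[OF f g] by (auto simp: fun_eq_iff)
  define M where "M = distr lborel borel f"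
  have M: "emeasure M X = emeasure lborel (f -` X)" if "X \<in> sets borel" for X
    unfolding M_def using that by (subst emeasure_distr) auto
  have "emeasure M A * emeasure lborel B = emeasure lborel A * emeasure M B"
  proof (rule emeasure_translation_invariant_mult_commute[where S = UNIV])
    fix x :: 'a and X :: "'a set" assume [measurable]: "X \<in> sets borel"
    have "f -` ((+) x -` X) = (+) (g x) -` (f -` X)"
      by (auto simp: linear_add[OF f] fg)
    then show "emeasure M ((+) x -` X) = emeasure M X"
      using measurable_sets[of f borel borel X] measurable_sets[of "(+) x" borel borel X]
      by (simp add: M emeasure_lborel_vimage_plus)
    show "emeasure lborel ((+) x -` X) = emeasure lborel X"
      by (simp add: emeasure_lborel_vimage_plus)
  next
    fix n :: nat
    have "f -` cball 0 (real n) = g ` cball 0 (real n)"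
    proof (intro set_eqI iffI)
      fix x assume "x \<in> f -` cball 0 (real n)"
      then show "x \<in> g ` cball 0 (real n)"
        using gf[of x] by (intro image_eqI[of _ _ "f x"]) auto
    qed (auto simp: fg)
    moreover have "bounded (g ` cball 0 (real n))"
      using g by (intro bounded_linear_image) (auto simp: linear_conv_bounded_linear)
    ultimately show "emeasure M (cball 0 (real n)) < \<infinity>"
      using emeasure_bounded_finite[of "f -` cball 0 (real n)"] by (simp add: M)
    show "emeasure lborel (cball (0::'a) (real n)) < \<infinity>"
      by (rule emeasure_bounded_finite) auto
  qed (use A B in \<open>auto simp: M_def\<close>)
  then show ?thesis using A B by (simp add: M)
qed

lemma ennreal_mult_right_cancel:
  fixes a b c :: ennreal
  assumes "a * c = b * c" "c \<noteq> 0" "c \<noteq> top" shows "a = b"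
  using assms by (metis mult_divide_eq_ennreal)

text \<open>The unit ball, taken as reference set, is its own preimage, so the factor is 1.\<close>

lemma emeasure_lborel_vimage_orthogonal:
  fixes f :: "'a::euclidean_space \<Rightarrow> 'a"
  assumes f: "linear f" and g: "linear g" and fg: "\<And>x. f (g x) = x"
    and norm: "\<And>x. norm (f x) = norm x"
    and A: "A \<in> sets borel"
  shows "emeasure lborel (f -` A) = emeasure lborel A"
proof -
  let ?B = "cball (0::'a) 1"
  have "f -` ?B = ?B" "uminus -` ?B = ?B" by (auto simp: norm)
  then have "emeasure lborel (f -` A) * emeasure lborel ?B = emeasure lborel A * emeasure lborel ?B"
    using emeasure_lborel_vimage_linear[OF f g fg A, of ?B] by simp
  moreover have "emeasure lborel ?B \<noteq> 0"
    by (simp add: emeasure_cball unit_ball_vol_pos ennreal_eq_0_iff not_le)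
  moreover have "emeasure lborel ?B \<noteq> top"
    by (simp add: emeasure_cball)
  ultimately show ?thesis
    by (rule ennreal_mult_right_cancel)
qed

text \<open>Reflection in the hyperplane orthogonal to \<open>v\<close>. For \<open>v = 0\<close>
  the quotient is 0 and the map is the identity, as wanted in \<open>hausdorff_eq_cone\<close> when
  the two normals coincide.\<close>

definition reflect :: "'a::euclidean_space \<Rightarrow> 'a \<Rightarrow> 'a" where
  "reflect v x = x - (2 * (x \<bullet> v) / (v \<bullet> v)) *\<^sub>R v"

lemma linear_reflect: "linear (reflect v)"
  by (rule linearI) (auto simp: reflect_def algebra_simps inner_add_left add_divide_distrib)

lemma inner_reflect: "reflect v x \<bullet> v = - (x \<bullet> v)"
  by (cases "v = 0") (auto simp: reflect_def inner_diff_left)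

lemma reflect_reflect: "reflect v (reflect v x) = x"
  by (subst (1) reflect_def) (simp add: inner_reflect, simp add: reflect_def)

lemma norm_reflect: "norm (reflect v x) = norm x"
proof (cases "v = 0")
  case False
  then have "reflect v x \<bullet> reflect v x = x \<bullet> x"
    by (simp add: reflect_def inner_diff_left inner_diff_right inner_commute field_simps power2_eq_square)
  then show ?thesis by (simp add: norm_eq_sqrt_inner)
qed (simp add: reflect_def)

text \<open>Vectors of equal norm are mirror images in their bisecting hyperplane, whose normal is
  \<open>a - b\<close>. This supplies an isometry between any two hyperplanes at the same distance
  from the origin.\<close>

lemma reflect_swap:
  assumes "norm a = norm b" shows "reflect (a - b) a = b"
proof (cases "a = b")
  case False
  have "a \<bullet> a = b \<bullet> b" using assms by (simp add: norm_eq)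
  then have "2 * (a \<bullet> (a - b)) = (a - b) \<bullet> (a - b)"
    by (simp add: inner_diff_left inner_diff_right inner_commute)
  then show ?thesis using False by (simp add: reflect_def)
qed (simp add: reflect_def)

lemma emeasure_lborel_vimage_reflect:
  "A \<in> sets borel \<Longrightarrow> emeasure lborel (reflect v -` A) = emeasure lborel A"
  by (rule emeasure_lborel_vimage_orthogonal[OF linear_reflect linear_reflect reflect_reflect norm_reflect])

text \<open>The reflection in \<open>v\<close> conjugates the shear along \<open>v\<close> to its inverse, so both have the same
  determinant.\<close>

lemma emeasure_lborel_vimage_shear:
  fixes u v :: "'a::euclidean_space"
  assumes orth: "u \<bullet> v = 0" and A: "A \<in> sets borel"
  shows "emeasure lborel ((\<lambda>x. x + (x \<bullet> u) *\<^sub>R v) -` A) = emeasure lborel A"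
proof -
  define T where "T s x = x + (s * (x \<bullet> u)) *\<^sub>R v" for s x
  have lin: "linear (T s)" for s
    by (rule linearI) (auto simp: T_def algebra_simps inner_add_left)
  have inv: "T s (T (- s) x) = x" for s x
    using orth by (simp add: T_def inner_diff_left inner_commute[of v u])
  have [measurable]: "T s \<in> borel_measurable borel" for s
    using lin[of s] by (auto intro!: borel_measurable_continuous_onI linear_continuous_on simp: linear_conv_bounded_linear)
  let ?B = "cball (0::'a) 1" and ?m = "emeasure (lborel :: 'a measure)"
  have B: "?B \<in> sets borel" "uminus -` ?B = ?B" by auto
  have TB: "T s -` ?B \<in> sets borel" for s
    using measurable_sets[of "T s" borel borel ?B] by simp
  have conj: "reflect v (T s x) = T (- s) (reflect v x)" for s x
  proof (cases "v = 0")
    case False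
    have "reflect v x \<bullet> u = x \<bullet> u"
      using orth by (simp add: reflect_def inner_diff_left inner_commute[of v u])
    moreover have "v \<bullet> u = 0" using orth by (simp add: inner_commute)
    ultimately show ?thesis
      using False
      by (simp add: T_def reflect_def inner_add_left algebra_simps add_divide_distrib)
        (simp flip: scaleR_add_left)
  qed (simp add: T_def reflect_def)
  have "norm (T 1 (reflect v x)) = norm (T (- 1) x)" for x
    using conj[of "-1" x] norm_reflect[of v "T (- 1) x"] by simp
  then have "reflect v -` (T 1 -` ?B) = T (- 1) -` ?B"
    by auto
  then have eq: "?m (T 1 -` ?B) = ?m (T (- 1) -` ?B)"
    using emeasure_lborel_vimage_reflect[OF TB[of 1], of v] by simp
  \<comment> \<open>The two shears are inverse to each other, so their volume factors multiply to 1;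
    being equal and nonnegative, both are 1.\<close>
  have "T 1 -` (T (- 1) -` ?B) = ?B"
    using inv[of "-1"] by auto
  then have sq: "?m ?B * ?m ?B = ?m (T 1 -` ?B) * ?m (T 1 -` ?B)"
    using emeasure_lborel_vimage_linear[OF lin lin inv TB[of "-1"] B, of 1] eq by simp
  have pos: "?m ?B \<noteq> 0" "?m ?B \<noteq> top"
    by (simp_all add: emeasure_cball unit_ball_vol_pos ennreal_eq_0_iff not_le)
  have fin: "?m (T 1 -` ?B) \<noteq> top"
  proof
    assume "?m (T 1 -` ?B) = top"
    then have "?m ?B * ?m ?B = top"
      by (simp only: sq) (simp add: ennreal_mult_eq_top_iff)
    then show False using pos by (simp add: ennreal_mult_eq_top_iff)
  qed
  have "(enn2real (?m ?B))\<^sup>2 = (enn2real (?m (T 1 -` ?B)))\<^sup>2"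
    using arg_cong[OF sq, of enn2real] by (simp only: enn2real_mult power2_eq_square)
  then have "enn2real (?m ?B) = enn2real (?m (T 1 -` ?B))"
    by (rule power2_eq_imp_eq) (rule enn2real_nonneg)+
  then have TB1: "?m (T 1 -` ?B) = ?m ?B"
    using fin pos by (metis ennreal_enn2real less_top)
  have "?m (T 1 -` A) * ?m ?B = ?m A * ?m ?B"
    using emeasure_lborel_vimage_linear[OF lin lin inv A B, of 1] unfolding TB1 .
  then have "?m (T 1 -` A) = ?m A"
    using pos by (rule ennreal_mult_right_cancel)
  then show ?thesis by (simp add: T_def[abs_def])
qed

section \<open>Hausdorff measure on hyperplanes\<close>

text \<open>An isometry carries covers to covers and preserves all diameters, hence all
  weights.\<close>

lemma hausdorff_outer_image_le:
  fixes f :: "'a::metric_space \<Rightarrow> 'a"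
  assumes iso: "\<And>x y. dist (f x) (f y) = dist x y"
  shows "hausdorff_outer d (f ` A) \<le> hausdorff_outer d A"
proof -
  have bdd: "bounded (f ` U)" if "bounded U" for U
    using that unfolding bounded_def by (auto simp: iso) (metis iso)
  have diam: "diameter (f ` U) = diameter U" for U
  proof -
    have "(\<lambda>(x, y). dist x y) ` (f ` U \<times> f ` U) = (\<lambda>(x, y). dist x y) ` (U \<times> U)"
      by (force simp: iso image_iff)
    then show ?thesis by (simp add: diameter_def image_image)
  qed
  have weight: "hausdorff_weight d (f ` U) = hausdorff_weight d U" for U
    by (simp add: hausdorff_weight_def diam)
  have "hausdorff_content d \<delta> (f ` A) \<le> hausdorff_content d \<delta> A" for \<delta>
    unfolding hausdorff_content_def[of d \<delta> A]
  proof (rule INF_greatest, clarify)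
    fix U :: "nat \<Rightarrow> 'a set"
    assume "A \<subseteq> (\<Union>i. U i)" "\<forall>i. bounded (U i) \<and> diameter (U i) \<le> \<delta>"
    then have "hausdorff_content d \<delta> (f ` A) \<le> (\<Sum>i. hausdorff_weight d (f ` U i))"
      by (intro hausdorff_content_le) (auto simp: bdd diam simp flip: image_UN)
    then show "hausdorff_content d \<delta> (f ` A) \<le> (\<Sum>i. hausdorff_weight d (U i))"
      by (simp add: weight)
  qed
  then show ?thesis
    unfolding hausdorff_outer_def by (intro SUP_mono) auto
qed

lemma hausdorff_outer_vimage:
  fixes f :: "'a::metric_space \<Rightarrow> 'a"
  assumes iso: "\<And>x y. dist (f x) (f y) = dist x y" and surj: "surj f"
  shows "hausdorff_outer d (f -` A) = hausdorff_outer d A"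
proof (rule antisym)
  have "inj f" by (rule injI) (metis iso dist_eq_0_iff)
  have "dist (inv f x) (inv f y) = dist x y" for x y
    by (metis iso surj surj_f_inv_f)
  from hausdorff_outer_image_le[OF this, of d A]
  show "hausdorff_outer d (f -` A) \<le> hausdorff_outer d A"
    using \<open>inj f\<close> surj by (simp add: bij_vimage_eq_inv_image bij_def)
  show "hausdorff_outer d A \<le> hausdorff_outer d (f -` A)"
    using hausdorff_outer_image_le[OF iso, of d "f -` A"] surj by (simp add: surj_image_vimage_eq)
qed

text \<open>A finite cover is enumerated and padded with empty sets. These cost nothing even for
  \<open>d = 0\<close>, because \<open>hausdorff_weight\<close> treats the empty set
  separately.\<close>

lemma hausdorff_content_le_sum:
  assumes "finite I" "A \<subseteq> (\<Union>i\<in>I. U i)" "\<And>i. i \<in> I \<Longrightarrow> bounded (U i)"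
    "\<And>i. i \<in> I \<Longrightarrow> diameter (U i) \<le> \<delta>" "\<delta> \<ge> 0"
  shows "hausdorff_content d \<delta> A \<le> (\<Sum>i\<in>I. hausdorff_weight d (U i))"
proof -
  obtain h where h: "bij_betw h {0..<card I} I"
    using ex_bij_betw_nat_finite[OF \<open>finite I\<close>] by blast
  define V where "V n = (if n < card I then U (h n) else {})" for n
  have hI: "h n \<in> I" if "n < card I" for n
    using h that by (auto simp: bij_betw_def)
  have "A \<subseteq> (\<Union>n. V n)"
  proof
    fix x assume "x \<in> A"
    then obtain i where i: "i \<in> I" "x \<in> U i" using assms by blast
    then obtain n where "n < card I" "h n = i" using h by (force simp: bij_betw_def)
    then have "x \<in> V n" using i by (simp add: V_def)
    then show "x \<in> (\<Union>n. V n)" by blast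
  qed
  then have "hausdorff_content d \<delta> A \<le> (\<Sum>n. hausdorff_weight d (V n))"
    using assms hI by (intro hausdorff_content_le) (auto simp: V_def)
  also have "\<dots> = (\<Sum>n\<in>{0..<card I}. hausdorff_weight d (V n))"
    by (rule suminf_finite) (auto simp: V_def)
  also have "\<dots> = (\<Sum>n\<in>{0..<card I}. hausdorff_weight d (U (h n)))"
    by (simp add: V_def)
  also have "\<dots> = (\<Sum>i\<in>I. hausdorff_weight d (U i))"
    by (rule sum.reindex_bij_betw[OF h])
  finally show ?thesis .
qed

text \<open>Cover by the cells of a grid of width proportional to \<open>1 / k\<close>: there are at most \<open>(k + 1) ^ (DIM('a) - 1)\<close>
  of them that meet the set.\<close>

lemma hausdorff_outer_hyperplane_finite:
  fixes b :: "'a::euclidean_space"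
  assumes b: "b \<in> Basis"
  shows "hausdorff_outer (DIM('a) - 1) ({x. x \<bullet> b = 0} \<inter> cball 0 \<rho>) < \<infinity>"
proof -
  let ?d = "DIM('a) - 1" and ?A = "{x. x \<bullet> b = 0} \<inter> cball 0 \<rho>"
  define n where "n = real DIM('a)"
  have n: "n \<ge> 1" unfolding n_def by (simp add: Suc_leI)
  \<comment> \<open>The lower bound 1 keeps the grid width positive for every
    \<open>\<rho>\<close>.\<close>
  define \<sigma> where "\<sigma> = max \<rho> 1"
  have \<sigma>: "\<sigma> \<ge> 1" "\<rho> \<le> \<sigma>" by (auto simp: \<sigma>_def)
  \<comment> \<open>There are \<open>(k + 1) ^ (DIM('a) - 1)\<close> cells of diameter at most
    \<open>2 * n * \<sigma> / k\<close>; the factor 2 in \<open>C\<close> absorbs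
    \<open>(k + 1) / k \<le> 2\<close>, which makes the bound independent of
    \<open>k\<close>.\<close>
  define C where "C = unit_ball_vol (real ?d) * (2 * n * \<sigma>) ^ ?d"
  have main: "hausdorff_content ?d (n * (2 * \<sigma> / real k)) ?A \<le> ennreal C" if k: "k \<ge> 1" for k
  proof -
    define \<eta> where "\<eta> = 2 * \<sigma> / real k"
    have \<eta>: "\<eta> > 0" using \<sigma> k by (simp add: \<eta>_def)
    define q where "q x = (\<lambda>i\<in>Basis - {b}. nat \<lfloor>(x \<bullet> i + \<sigma>) / \<eta>\<rfloor>)" for x :: 'a
    \<comment> \<open>The index \<open>k\<close> does occur, at coordinates equal to
      \<open>\<sigma>\<close>, so each coordinate takes \<open>k + 1\<close> values. The coordinate
      along \<open>b\<close> vanishes and is not subdivided.\<close>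
    define J where "J = (\<Pi>\<^sub>E i\<in>Basis - {b}. {0..k})"
    define cell where "cell j = {x \<in> ?A. q x = j}" for j
    have comp: "0 \<le> x \<bullet> i + \<sigma>" "x \<bullet> i + \<sigma> \<le> 2 * \<sigma>" if "x \<in> ?A" "i \<in> Basis" for x i
      using Basis_le_norm[OF that(2), of x] that(1) \<sigma> by (auto simp: abs_le_iff)
    have cov: "?A \<subseteq> (\<Union>j\<in>J. cell j)"
    proof
      fix x assume x: "x \<in> ?A"
      have "nat \<lfloor>(x \<bullet> i + \<sigma>) / \<eta>\<rfloor> \<le> k" if "i \<in> Basis" for i
      proof -
        have "(x \<bullet> i + \<sigma>) / \<eta> \<le> 2 * \<sigma> / \<eta>"
          using comp[OF x that] \<eta> by (intro divide_right_mono) auto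
        also have "\<dots> = real k" using \<sigma> k by (simp add: \<eta>_def)
        finally show ?thesis by linarith
      qed
      then have "q x \<in> J" by (auto simp: q_def J_def)
      then show "x \<in> (\<Union>j\<in>J. cell j)" using x by (auto simp: cell_def)
    qed
    have dist: "norm (x - y) \<le> n * \<eta>" if "x \<in> cell j" "y \<in> cell j" for x y j
    proof -
      have "\<bar>(x - y) \<bullet> i\<bar> \<le> \<eta>" if i: "i \<in> Basis" for i
      proof (cases "i = b")
        case True
        then show ?thesis using \<open>x \<in> cell j\<close> \<open>y \<in> cell j\<close> \<eta> by (simp add: cell_def inner_diff_left)
      next
        case False
        have xA: "x \<in> ?A" and yA: "y \<in> ?A"
          using \<open>x \<in> cell j\<close> \<open>y \<in> cell j\<close> by (auto simp: cell_def)
        have "q x i = q y i" using \<open>x \<in> cell j\<close> \<open>y \<in> cell j\<close> by (auto simp: cell_def)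
        then have "nat \<lfloor>(x \<bullet> i + \<sigma>) / \<eta>\<rfloor> = nat \<lfloor>(y \<bullet> i + \<sigma>) / \<eta>\<rfloor>"
          using i False by (simp add: q_def)
        moreover have "0 \<le> (x \<bullet> i + \<sigma>) / \<eta>" "0 \<le> (y \<bullet> i + \<sigma>) / \<eta>"
          using comp(1)[OF xA i] comp(1)[OF yA i] \<eta> by (auto intro: divide_nonneg_nonneg)
        ultimately have "\<bar>(x \<bullet> i + \<sigma>) / \<eta> - (y \<bullet> i + \<sigma>) / \<eta>\<bar> \<le> 1"
          by linarith
        moreover have "(x \<bullet> i + \<sigma>) / \<eta> - (y \<bullet> i + \<sigma>) / \<eta> = ((x - y) \<bullet> i) / \<eta>"
          by (simp add: inner_diff_left diff_divide_distrib add_divide_distrib)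
        ultimately show ?thesis using \<eta> by (simp add: abs_divide)
      qed
      then have "(\<Sum>i\<in>Basis. \<bar>(x - y) \<bullet> i\<bar>) \<le> (\<Sum>i\<in>(Basis::'a set). \<eta>)"
        by (rule sum_mono)
      then show ?thesis using norm_le_l1[of "x - y"] by (simp add: n_def)
    qed
    have diam: "diameter (cell j) \<le> n * \<eta>" for j
      by (rule diameter_le) (use dist n \<eta> in auto)
    have bdd: "bounded (cell j)" for j
      by (rule bounded_subset[of "cball 0 \<rho>"]) (auto simp: cell_def)
    have finJ: "finite J" by (simp add: J_def finite_PiE)
    have cardJ: "card J = (k + 1) ^ ?d"
      using b by (simp add: J_def card_PiE)
    have "hausdorff_content ?d (n * \<eta>) ?A \<le> (\<Sum>j\<in>J. hausdorff_weight ?d (cell j))"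
      by (rule hausdorff_content_le_sum[OF finJ cov bdd diam]) (use n \<eta> in auto)
    also have "\<dots> \<le> (\<Sum>j\<in>J. ennreal (unit_ball_vol (real ?d) * (n * \<eta> / 2) ^ ?d))"
    proof (rule sum_mono)
      fix j
      have "(diameter (cell j) / 2) ^ ?d \<le> (n * \<eta> / 2) ^ ?d"
        using diam[of j] diameter_ge_0[OF bdd[of j]] by (intro power_mono) auto
      then show "hausdorff_weight ?d (cell j) \<le> ennreal (unit_ball_vol (real ?d) * (n * \<eta> / 2) ^ ?d)"
        by (auto simp: hausdorff_weight_def intro!: ennreal_leI mult_left_mono)
    qed
    also have "\<dots> = ennreal (real ((k + 1) ^ ?d) * (unit_ball_vol (real ?d) * (n * \<eta> / 2) ^ ?d))"
      using n \<eta> by (simp add: cardJ ennreal_of_nat_eq_real_of_nat ennreal_mult' del: of_nat_power)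
    also have "real ((k + 1) ^ ?d) * (unit_ball_vol (real ?d) * (n * \<eta> / 2) ^ ?d)
        = unit_ball_vol (real ?d) * (real (k + 1) * (n * \<eta> / 2)) ^ ?d"
      by (simp only: of_nat_power power_mult_distrib mult_ac)
    also have "ennreal \<dots> \<le> ennreal C"
    proof -
      have "real (k + 1) * (n * \<eta> / 2) = n * \<sigma> * (real (k + 1) / real k)"
        using k by (simp add: \<eta>_def)
      also have "\<dots> \<le> n * \<sigma> * 2"
        using n \<sigma> k by (intro mult_left_mono) (auto simp: field_simps)
      finally show ?thesis
        unfolding C_def using n \<eta> by (intro ennreal_leI mult_left_mono power_mono) (auto simp: mult_ac)
    qed
    finally show ?thesis by (simp add: \<eta>_def)
  qed
  have "hausdorff_outer ?d ?A \<le> ennreal C"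
    unfolding hausdorff_outer_def
  proof (rule SUP_least)
    fix \<delta> :: real assume "\<delta> \<in> {0<..}"
    then have \<delta>: "\<delta> > 0" by simp
    obtain k :: nat where k: "real k > n * (2 * \<sigma>) / \<delta>" using reals_Archimedean2 by blast
    have "n * (2 * \<sigma>) / \<delta> > 0" using n \<sigma> \<delta> by auto
    then have k0: "k \<ge> 1" using k by (cases k) auto
    have "n * (2 * \<sigma> / real k) \<le> \<delta>" using k k0 \<delta> by (simp add: field_simps)
    then have "hausdorff_content ?d \<delta> ?A \<le> hausdorff_content ?d (n * (2 * \<sigma> / real k)) ?A"
      by (rule hausdorff_content_antimono)
    also have "\<dots> \<le> ennreal C" by (rule main[OF k0])
    finally show "hausdorff_content ?d \<delta> ?A \<le> ennreal C" .
  qed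
  then show ?thesis by (simp add: le_less_trans)
qed

text \<open>If the unit cube of the hyperplane is covered by the \<open>U i\<close>, then the unit cube of the whole space
  is covered by boxes of volume \<open>(2 * diameter (U i)) ^ (DIM('a) - 1)\<close>.\<close>

lemma hausdorff_outer_hyperplane_pos:
  fixes b :: "'a::euclidean_space"
  assumes b: "b \<in> Basis"
  shows "hausdorff_outer (DIM('a) - 1) ({x. x \<bullet> b = 0} \<inter> cbox 0 One) > 0"
proof -
  let ?d = "DIM('a) - 1" and ?Q = "{x. x \<bullet> b = 0} \<inter> cbox 0 (One::'a)"
  \<comment> \<open>The ratio of box volume to weight:
    \<open>(2 * D) ^ d = 4 ^ d * (D / 2) ^ d\<close> for a set of diameter \<open>D\<close> and
    \<open>d = DIM('a) - 1\<close>.\<close>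
  define K where "K = ennreal (4 ^ ?d / unit_ball_vol (real ?d))"
  have vol: "unit_ball_vol (real ?d) > 0" by (simp add: unit_ball_vol_pos)
  have "ennreal (unit_ball_vol (real ?d) / 4 ^ ?d) \<le> hausdorff_content ?d 1 ?Q"
    unfolding hausdorff_content_def
  proof (rule INF_greatest, clarify)
    fix U :: "nat \<Rightarrow> 'a set"
    assume cov: "?Q \<subseteq> (\<Union>i. U i)" and U: "\<forall>i. bounded (U i) \<and> diameter (U i) \<le> 1"
    have "1 \<le> K * (\<Sum>i. hausdorff_weight ?d (U i))"
    proof -
      define s where "s i = (SOME x. x \<in> U i)" for i
      define lo where "lo i = (\<Sum>e\<in>Basis. (if e = b then 0 else s i \<bullet> e - diameter (U i)) *\<^sub>R e)" for i
      define hi where "hi i = (\<Sum>e\<in>Basis. (if e = b then 1 else s i \<bullet> e + diameter (U i)) *\<^sub>R e)" for i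
      have lo: "lo i \<bullet> e = (if e = b then 0 else s i \<bullet> e - diameter (U i))" if "e \<in> Basis" for i e
        using that by (simp add: lo_def)
      have hi: "hi i \<bullet> e = (if e = b then 1 else s i \<bullet> e + diameter (U i))" if "e \<in> Basis" for i e
        using that by (simp add: hi_def)
      \<comment> \<open>An empty \<open>U i\<close> has weight 0 and must get an empty box: for
        \<open>DIM('a) = 1\<close> the box from \<open>lo i\<close> to \<open>hi i\<close> has
        volume 1 regardless of \<open>U i\<close>.\<close>
      define X where "X i = (if U i = {} then {} else cbox (lo i) (hi i))" for i
      have diam0: "diameter (U i) \<ge> 0" for i using U by (simp add: diameter_ge_0)
      have "cbox 0 One \<subseteq> (\<Union>i. X i)"
      proof
        fix x :: 'a assume x: "x \<in> cbox 0 One"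
        define y where "y = x - (x \<bullet> b) *\<^sub>R b"
        have ye: "y \<bullet> e = (if e = b then 0 else x \<bullet> e)" if "e \<in> Basis" for e
          using b that by (auto simp: y_def inner_diff_left inner_Basis)
        have "y \<in> ?Q" using x b by (auto simp: mem_box ye)
        then obtain i where i: "y \<in> U i" using cov by blast
        then have "s i \<in> U i" unfolding s_def by (rule someI)
        then have "dist y (s i) \<le> diameter (U i)" using i U by (intro diameter_bounded_bound) auto
        then have "\<bar>(y - s i) \<bullet> e\<bar> \<le> diameter (U i)" if "e \<in> Basis" for e
          using Basis_le_norm[OF that, of "y - s i"] by (simp add: dist_norm)
        then have "lo i \<bullet> e \<le> x \<bullet> e \<and> x \<bullet> e \<le> hi i \<bullet> e" if "e \<in> Basis" for e
          using that x by (fastforce simp: lo hi ye mem_box inner_diff_left abs_le_iff)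
        then have "x \<in> X i" using i by (auto simp: X_def mem_box)
        then show "x \<in> (\<Union>i. X i)" by blast
      qed
      have vX: "emeasure lborel (X i) = K * hausdorff_weight ?d (U i)" for i
      proof (cases "U i = {}")
        case False
        have le: "lo i \<bullet> e \<le> hi i \<bullet> e" if "e \<in> Basis" for e
          using that diam0[of i] by (simp add: lo hi)
        have "emeasure lborel (X i) = ennreal (\<Prod>e\<in>Basis. (hi i - lo i) \<bullet> e)"
          using False le by (simp add: X_def)
        also have "(\<Prod>e\<in>Basis. (hi i - lo i) \<bullet> e) = (\<Prod>e\<in>Basis. if e = b then 1 else 2 * diameter (U i))"
          by (intro prod.cong) (auto simp: inner_diff_left lo hi)
        also have "\<dots> = (\<Prod>e\<in>Basis - {b}. 2 * diameter (U i))"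
          by (subst prod.remove[OF finite_Basis b]) auto
        also have "\<dots> = (2 * diameter (U i)) ^ ?d"
          using b by simp
        also have "\<dots> = 4 ^ ?d / unit_ball_vol (real ?d) * (unit_ball_vol (real ?d) * (diameter (U i) / 2) ^ ?d)"
        proof -
          have "(2 * diameter (U i)) ^ ?d = (4 * (diameter (U i) / 2)) ^ ?d" by simp
          also have "\<dots> = 4 ^ ?d * (diameter (U i) / 2) ^ ?d" by (rule power_mult_distrib)
          finally show ?thesis using less_imp_neq[OF vol] by (simp del: One_nat_def)
        qed
        also have "ennreal \<dots> = K * hausdorff_weight ?d (U i)"
          using False diam0[of i] vol
          by (simp add: K_def hausdorff_weight_def ennreal_mult''[symmetric] del: One_nat_def)
        finally show ?thesis .
      qed (simp add: X_def)
      have "1 = emeasure lborel (cbox 0 (One::'a))"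
        by (subst emeasure_lborel_cbox) auto
      also have "\<dots> \<le> emeasure lborel (\<Union>i. X i)"
        using \<open>cbox 0 One \<subseteq> (\<Union>i. X i)\<close> by (intro emeasure_mono) (auto simp: X_def)
      also have "\<dots> \<le> (\<Sum>i. emeasure lborel (X i))"
        by (intro emeasure_subadditive_countably) (auto simp: X_def)
      also have "\<dots> = K * (\<Sum>i. hausdorff_weight ?d (U i))"
        by (simp add: vX)
      finally show ?thesis .
    qed
    then have "ennreal (unit_ball_vol (real ?d) / 4 ^ ?d) * 1
        \<le> ennreal (unit_ball_vol (real ?d) / 4 ^ ?d) * (K * (\<Sum>i. hausdorff_weight ?d (U i)))"
      by (rule mult_left_mono) simp
    also have "\<dots> = (\<Sum>i. hausdorff_weight ?d (U i))"
      using vol less_imp_neq[OF vol]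
      by (simp add: K_def mult.assoc[symmetric] ennreal_mult[symmetric] del: One_nat_def)
    finally show "ennreal (unit_ball_vol (real ?d) / 4 ^ ?d) \<le> (\<Sum>i. hausdorff_weight ?d (U i))"
      by simp
  qed
  moreover have "ennreal (unit_ball_vol (real ?d) / 4 ^ ?d) > 0"
    using vol by (simp del: One_nat_def)
  moreover have "hausdorff_content ?d 1 ?Q \<le> hausdorff_outer ?d ?Q"
    by (rule hausdorff_content_le_outer) simp
  ultimately show ?thesis
    by (meson less_le_trans)
qed

text \<open>The apex \<open>c\<close>, where the quotient is \<open>r / 0\<close>, is excluded.\<close>

definition cone_over :: "'a::euclidean_space \<Rightarrow> real \<Rightarrow> 'a \<Rightarrow> 'a set \<Rightarrow> 'a set" where
  "cone_over c r u A =
    {x. 0 < (x - c) \<bullet> u \<and> (x - c) \<bullet> u \<le> r \<and> c + (r / ((x - c) \<bullet> u)) *\<^sub>R (x - c) \<in> A}"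

lemma cone_over_measurable [measurable]:
  assumes [measurable]: "A \<in> sets borel" shows "cone_over c r u A \<in> sets borel"
proof -
  have "{x \<in> space borel. 0 < (x - c) \<bullet> u \<and> (x - c) \<bullet> u \<le> r \<and>
      c + (r / ((x - c) \<bullet> u)) *\<^sub>R (x - c) \<in> A} \<in> sets borel"
    by measurable
  then show ?thesis by (simp add: cone_over_def)
qed

lemma emeasure_hausdorff_vimage:
  fixes f :: "'a::euclidean_space \<Rightarrow> 'a"
  assumes iso: "\<And>x y. dist (f x) (f y) = dist x y" and surj: "surj f" and A: "A \<in> sets borel"
  shows "emeasure (hausdorff_measure d) (f -` A) = emeasure (hausdorff_measure d) A"
proof -
  have "continuous_on UNIV f"
    unfolding continuous_on_iff by (auto simp: iso)
  then have "f \<in> borel_measurable borel" by (rule borel_measurable_continuous_onI)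
  then have "f -` A \<in> sets borel" using measurable_sets[of f borel borel A] A by simp
  then show ?thesis
    using A by (simp add: emeasure_hausdorff_measure hausdorff_outer_vimage[OF iso surj])
qed

text \<open>Surface measure and cone volume both become measures \<open>M\<close> and
  \<open>N\<close> on the parallel hyperplane \<open>S\<close> through the origin. Both are
  invariant under \<open>S\<close> and finite on balls, hence proportional; \<open>k\<close> is
  their ratio on one ball on which neither vanishes.\<close>

lemma hausdorff_eq_cone_Basis:
  fixes b :: "'a::euclidean_space"
  assumes b: "b \<in> Basis" and r: "r > 0"
  obtains k where "k > 0"
    "\<And>A. A \<in> sets borel \<Longrightarrow> A \<subseteq> {x. x \<bullet> b = r} \<Longrightarrow>
      emeasure surface_measure A = ennreal k * emeasure lborel (cone_over 0 r b A)"
proof -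
  let ?H = "surface_measure :: 'a measure"
  define S where "S = {x. x \<bullet> b = 0}"
  have S: "subspace S" by (auto simp: S_def subspace_def inner_add_left)
  have bb: "b \<bullet> b = 1" using b by simp
  have [measurable]: "S \<in> sets borel"
    using closed_subspace[OF S] by (rule borel_closed)
  define M where "M = density ?H (indicator S)"
  have sM: "sets M = sets borel" by (simp add: M_def)
  have M: "emeasure M A = emeasure ?H (S \<inter> A)" if "A \<in> sets borel" for A
    using that unfolding M_def
    by (subst emeasure_density) (auto simp: nn_integral_indicator[symmetric] indicator_inter_arith[symmetric] simp del: nn_integral_indicator)
  define D where "D = {x. 0 < x \<bullet> b \<and> x \<bullet> b \<le> r}"
  have "{x \<in> space borel. 0 < x \<bullet> b \<and> x \<bullet> b \<le> r} \<in> sets borel" by measurable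
  then have [measurable]: "D \<in> sets borel" by (simp add: D_def)
  \<comment> \<open>Central projection onto the hyperplane at height \<open>r\<close>, followed by
    the translation of that hyperplane to \<open>S\<close>.\<close>
  define p where "p x = (r / (x \<bullet> b)) *\<^sub>R x - r *\<^sub>R b" for x
  have [measurable]: "p \<in> borel_measurable borel" unfolding p_def by measurable
  define N where "N = distr (density lborel (indicator D)) borel p"
  have sN: "sets N = sets borel" by (simp add: N_def)
  have pA: "p -` A \<in> sets borel" if "A \<in> sets borel" for A
    using measurable_sets[of p borel borel A] that by simp
  have N: "emeasure N A = emeasure lborel (D \<inter> p -` A)" if "A \<in> sets borel" for A
    using that pA[OF that] unfolding N_def
    by (subst emeasure_distr, simp_all, subst emeasure_density)
      (auto simp: nn_integral_indicator[symmetric] indicator_inter_arith[symmetric] simp del: nn_integral_indicator)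
  have pS: "p x \<in> S" if "x \<in> D" for x
    using that bb by (simp add: p_def S_def D_def inner_diff_left)
  have Mfin: "emeasure M (cball 0 (real n)) < \<infinity>" for n
    using hausdorff_outer_hyperplane_finite[OF b, of "real n", folded S_def]
    by (simp add: M emeasure_hausdorff_measure)
  have Nfin: "emeasure N (cball 0 (real n)) < \<infinity>" for n
  proof -
    \<comment> \<open>On the slab \<open>D\<close> the projection scales by
      \<open>r / (x \<bullet> b) \<ge> 1\<close>, so it cannot send far points near the
      origin.\<close>
    have "D \<inter> p -` cball 0 (real n) \<subseteq> cball 0 (real n + r)"
    proof
      fix x assume x: "x \<in> D \<inter> p -` cball 0 (real n)"
      have "norm ((r / (x \<bullet> b)) *\<^sub>R x) \<le> real n + r"
        using x r b norm_triangle_sub[of "(r / (x \<bullet> b)) *\<^sub>R x" "r *\<^sub>R b"] by (simp add: p_def)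
      moreover have "r / (x \<bullet> b) \<ge> 1" using x by (simp add: D_def)
      then have "1 * norm x \<le> r / (x \<bullet> b) * norm x" by (intro mult_right_mono) auto
      ultimately show "x \<in> cball 0 (real n + r)" using x r by (simp add: D_def)
    qed
    then have "bounded (D \<inter> p -` cball 0 (real n))" by (rule bounded_subset[OF bounded_cball])
    then have "emeasure lborel (D \<inter> p -` cball 0 (real n)) < \<infinity>" by (rule emeasure_bounded_finite)
    then show ?thesis by (simp add: N)
  qed
  \<comment> \<open>The radius lets the ball contain the unit cube, whose slice by \<open>S\<close>
    is known to have positive Hausdorff measure.\<close>
  let ?B = "cball (0::'a) (real DIM('a))"
  have eq: "emeasure M A * emeasure N ?B = emeasure N A * emeasure M ?B" if "A \<in> sets borel" for A
  proof (rule emeasure_translation_invariant_mult_commute[OF sM sN S])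
    show "emeasure M (- S) = 0" by (simp add: M)
    have "D \<inter> p -` (- S) = {}" using pS by auto
    then show "emeasure N (- S) = 0" by (simp add: N)
  next
    fix v :: 'a and X :: "'a set" assume v: "v \<in> S" and X[measurable]: "X \<in> sets borel"
    have vX[measurable]: "(+) v -` X \<in> sets borel"
      using measurable_sets[of "(+) v" borel borel X] by simp
    have "S \<inter> (+) v -` X = (+) v -` (S \<inter> X)"
      using v by (auto simp: S_def inner_add_left)
    moreover have "emeasure ?H ((+) v -` (S \<inter> X)) = emeasure ?H (S \<inter> X)"
      by (rule emeasure_hausdorff_vimage) auto
    ultimately show "emeasure M ((+) v -` X) = emeasure M X"
      using vX X by (simp add: M)
    have vb: "v \<bullet> b = 0" "b \<bullet> v = 0" using v by (auto simp: S_def inner_commute)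
    \<comment> \<open>The shear leaves the height \<open>x \<bullet> b\<close> unchanged; projection
      multiplies its displacement \<open>(x \<bullet> b) / r\<close> times \<open>v\<close> by
      \<open>r / (x \<bullet> b)\<close>, which gives exactly \<open>v\<close>.\<close>
    have "D \<inter> p -` ((+) v -` X) = (\<lambda>x. x + (x \<bullet> b) *\<^sub>R ((1 / r) *\<^sub>R v)) -` (D \<inter> p -` X)"
    proof (intro set_eqI)
      fix x
      define y where "y = x + (x \<bullet> b) *\<^sub>R ((1 / r) *\<^sub>R v)"
      have yb: "y \<bullet> b = x \<bullet> b" by (simp add: y_def inner_add_left vb)
      have "v + p x = p y" if "x \<bullet> b \<noteq> 0"
        using that r by (simp add: p_def yb) (simp add: y_def algebra_simps)
      then have "x \<in> D \<inter> p -` ((+) v -` X) \<longleftrightarrow> y \<in> D \<inter> p -` X"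
        by (auto simp: D_def yb)
      then show "x \<in> D \<inter> p -` ((+) v -` X) \<longleftrightarrow>
          x \<in> (\<lambda>x. x + (x \<bullet> b) *\<^sub>R ((1 / r) *\<^sub>R v)) -` (D \<inter> p -` X)"
        by (simp only: vimage_eq y_def)
    qed
    moreover have "D \<inter> p -` X \<in> sets borel" using pA[OF X] by measurable
    ultimately show "emeasure N ((+) v -` X) = emeasure N X"
      using vX X emeasure_lborel_vimage_shear[of b "(1 / r) *\<^sub>R v" "D \<inter> p -` X"]
      by (simp add: N vb)
  next
    fix n :: nat
    show "emeasure M (cball 0 (real n)) < \<infinity>" "emeasure N (cball 0 (real n)) < \<infinity>"
      by (rule Mfin Nfin)+
  qed (use that in auto)
  have M0: "emeasure M ?B \<noteq> 0"
  proof -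
    have "cbox 0 One \<subseteq> ?B"
    proof
      fix x :: 'a assume "x \<in> cbox 0 One"
      then have "(\<Sum>i\<in>Basis. \<bar>x \<bullet> i\<bar>) \<le> (\<Sum>i\<in>(Basis::'a set). 1)"
        by (intro sum_mono) (auto simp: mem_box)
      then show "x \<in> ?B" using norm_le_l1[of x] by simp
    qed
    then have "emeasure ?H ({x. x \<bullet> b = 0} \<inter> cbox 0 One) \<le> emeasure ?H (S \<inter> ?B)"
      by (intro emeasure_mono) (auto simp: S_def[symmetric])
    moreover have "{x. x \<bullet> b = 0} \<inter> cbox 0 One \<in> sets borel"
      by (auto simp: S_def[symmetric])
    ultimately show ?thesis
      using hausdorff_outer_hyperplane_pos[OF b] by (auto simp: M emeasure_hausdorff_measure)
  qed
  have Mf: "emeasure M ?B \<noteq> top" and Nf: "emeasure N ?B \<noteq> top"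
    using Mfin[of "DIM('a)"] Nfin[of "DIM('a)"] by (simp_all add: less_top)
  have N0: "emeasure N ?B \<noteq> 0"
  proof -
    \<comment> \<open>Positivity of \<open>N\<close> on the ball: \<open>p\<close> is continuous on
      this open slab and sends its point \<open>(r / 2) *\<^sub>R b\<close> to 0, so a whole
      neighbourhood of that point is counted.\<close>
    define G where "G = {x. 0 < x \<bullet> b} \<inter> {x. x \<bullet> b < r}"
    have "open G"
      unfolding G_def using open_halfspace_gt[of 0 b] open_halfspace_lt[of b r]
      by (intro open_Int) (simp_all add: inner_commute)
    moreover have "continuous_on G p"
      unfolding p_def by (intro continuous_intros) (auto simp: G_def)
    ultimately have "open (p -` ball 0 1 \<inter> G)"
      using continuous_on_open_vimage open_ball by blast
    moreover have "p ((r / 2) *\<^sub>R b) = 0" "(r / 2) *\<^sub>R b \<in> G"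
      using r bb by (auto simp: p_def G_def)
    then have "(r / 2) *\<^sub>R b \<in> p -` ball 0 1 \<inter> G" by simp
    ultimately obtain e where e: "e > 0" "ball ((r / 2) *\<^sub>R b) e \<subseteq> p -` ball 0 1 \<inter> G"
      by (meson openE)
    have "p -` ball 0 1 \<inter> G \<subseteq> D \<inter> p -` ?B"
    proof
      fix x assume x: "x \<in> p -` ball 0 1 \<inter> G"
      have "1 \<le> real DIM('a)" by (simp add: Suc_leI)
      moreover have "norm (p x) < 1" using x by simp
      ultimately have "norm (p x) \<le> real DIM('a)" by linarith
      then show "x \<in> D \<inter> p -` ?B" using x by (auto simp: G_def D_def)
    qed
    then have "emeasure lborel (ball ((r / 2) *\<^sub>R b) e) \<le> emeasure N ?B"
      using e pA[of ?B] by (subst N) (auto intro!: emeasure_mono)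
    moreover have "emeasure lborel (ball ((r / 2) *\<^sub>R b) e) \<noteq> 0"
      using e by (simp add: emeasure_ball unit_ball_vol_pos ennreal_eq_0_iff not_le)
    ultimately show ?thesis by auto
  qed
  define k where "k = enn2real (emeasure M ?B) / enn2real (emeasure N ?B)"
  have k: "k > 0" unfolding k_def using M0 Mf N0 Nf
    by (auto simp: enn2real_positive_iff less_top zero_less_iff_neq_zero)
  have kk: "ennreal k * emeasure N ?B = emeasure M ?B"
  proof -
    have "enn2real (emeasure N ?B) > 0" "enn2real (emeasure M ?B) \<ge> 0"
      using N0 Nf by (auto simp: enn2real_positive_iff less_top zero_less_iff_neq_zero)
    then have "ennreal k * ennreal (enn2real (emeasure N ?B)) = ennreal (enn2real (emeasure M ?B))"
      using k by (subst ennreal_mult[symmetric]) (auto simp: k_def)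
    then show ?thesis using Nf Mf by (simp add: less_top)
  qed
  show thesis
  proof (rule that[OF k])
    fix A :: "'a set" assume A[measurable]: "A \<in> sets borel" and sub: "A \<subseteq> {x. x \<bullet> b = r}"
    define A' where "A' = (+) (r *\<^sub>R b) -` A"
    have A': "A' \<in> sets borel"
      using measurable_sets[of "(+) (r *\<^sub>R b)" borel borel A] by (simp add: A'_def)
    have "A' \<subseteq> S" using sub bb by (auto simp: A'_def S_def inner_add_left)
    then have "emeasure M A' = emeasure ?H A'"
      using A' by (simp add: M Int_absorb1)
    also have "\<dots> = emeasure ?H A"
      unfolding A'_def using A by (intro emeasure_hausdorff_vimage) auto
    finally have 1: "emeasure ?H A = emeasure M A'" ..
    have "D \<inter> p -` A' = cone_over 0 r b A"
      by (auto simp: cone_over_def D_def p_def A'_def)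
    then have 2: "emeasure N A' = emeasure lborel (cone_over 0 r b A)"
      using A' by (simp add: N)
    have "emeasure M A' * emeasure N ?B = (ennreal k * emeasure N A') * emeasure N ?B"
      by (simp only: eq[OF A'] kk[symmetric] mult_ac)
    then have "emeasure M A' = ennreal k * emeasure N A'"
      using N0 Nf by (rule ennreal_mult_right_cancel)
    then show "emeasure ?H A = ennreal k * emeasure lborel (cone_over 0 r b A)"
      by (simp only: 1 2)
  qed
qed

text \<open>The constant does not depend on the hyperplane, since all hyperplanes are congruent.\<close>

lemma hausdorff_eq_cone:
  fixes c :: "'a::euclidean_space"
  assumes r: "r > 0"
  obtains k where "k > 0"
    "\<And>u A. norm u = 1 \<Longrightarrow> A \<in> sets borel \<Longrightarrow> A \<subseteq> {x. (x - c) \<bullet> u = r} \<Longrightarrow>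
      emeasure surface_measure A = ennreal k * emeasure lborel (cone_over c r u A)"
proof -
  obtain b :: 'a where b: "b \<in> Basis" using nonempty_Basis by blast
  obtain k where k: "k > 0" and eq: "\<And>A. A \<in> sets borel \<Longrightarrow> A \<subseteq> {x. x \<bullet> b = r} \<Longrightarrow>
      emeasure surface_measure A = ennreal k * emeasure lborel (cone_over 0 r b A)"
    using hausdorff_eq_cone_Basis[OF b r] by metis
  show thesis
  proof (rule that[OF k])
    fix u :: 'a and A
    assume u: "norm u = 1" and A[measurable]: "A \<in> sets borel" and sub: "A \<subseteq> {x. (x - c) \<bullet> u = r}"
    \<comment> \<open>The reflection swaps \<open>u\<close> and \<open>b\<close>, so
      \<open>f\<close> carries the hyperplane at height \<open>r\<close> over \<open>b\<close> to
      the given one and the cone with apex 0 to the cone with apex \<open>c\<close>.\<close>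
    define v where "v = b - u"
    define f where "f x = c + reflect v x" for x
    have fu: "reflect v u = b" 
      using reflect_swap[of b u] u b reflect_reflect[of v b] by (simp add: v_def)
    have inner: "reflect v x \<bullet> reflect v y = x \<bullet> y" for x y
    proof -
      have "norm (reflect v (x + y)) = norm (x + y)" by (rule norm_reflect)
      then show ?thesis
        using norm_reflect[of v x] norm_reflect[of v y]
        by (simp add: linear_add[OF linear_reflect] norm_eq inner_add_left inner_add_right inner_commute)
    qed
    have inner': "reflect v x \<bullet> u = x \<bullet> b" for x
      using inner[of x b] fu reflect_reflect[of v u] by simp
    have iso: "dist (f x) (f y) = dist x y" for x y
      by (simp add: f_def dist_norm linear_diff[OF linear_reflect, symmetric] norm_reflect)
    have surj: "surj f"
      by (rule surjI[of _ "\<lambda>y. reflect v (y - c)"]) (simp add: f_def reflect_reflect)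
    have "continuous_on UNIV f"
      unfolding continuous_on_iff by (auto simp: iso)
    then have [measurable]: "f \<in> borel_measurable borel" by (rule borel_measurable_continuous_onI)
    have fA: "f -` A \<in> sets borel" using measurable_sets[of f borel borel A] by simp
    have "emeasure surface_measure A = emeasure surface_measure (f -` A)"
      using emeasure_hausdorff_vimage[OF iso surj A] by simp
    also have "\<dots> = ennreal k * emeasure lborel (cone_over 0 r b (f -` A))"
      using fA sub by (intro eq) (auto simp: f_def inner')
    also have "cone_over 0 r b (f -` A) = reflect v -` ((+) c -` cone_over c r u A)"
      by (auto simp: cone_over_def f_def inner' linear_scale[OF linear_reflect])
    also have "emeasure lborel \<dots> = emeasure lborel (cone_over c r u A)"
      using measurable_sets[of "(+) c" borel borel "cone_over c r u A"]
      by (simp add: emeasure_lborel_vimage_reflect emeasure_lborel_vimage_plus)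
    finally show "emeasure surface_measure A = ennreal k * emeasure lborel (cone_over c r u A)" .
  qed
qed

section \<open>The radial projection of a circumscribed body\<close>

lemma emeasure_lborel_vimage_homothety:
  fixes c :: "'a::euclidean_space"
  assumes t: "t > 0" and X: "X \<in> sets borel"
  shows "emeasure lborel ((\<lambda>x. c + (1 / t) *\<^sub>R (x - c)) -` X) = ennreal (t ^ DIM('a)) * emeasure lborel X"
proof -
  define T where "T x = (c - (1 / t) *\<^sub>R c) + (1 / t) *\<^sub>R x" for x
  have [measurable]: "T \<in> borel_measurable borel" unfolding T_def by measurable
  have T: "c + (1 / t) *\<^sub>R (x - c) = T x" for x by (simp add: T_def algebra_simps)
  have TX: "T -` X \<in> sets borel" using measurable_sets[of T borel borel X] X by simp
  have "emeasure lborel X = emeasure (density (distr lborel borel T) (\<lambda>_. \<bar>1 / t\<bar> ^ DIM('a))) X"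
    using t unfolding T_def by (subst lborel_affine[symmetric]) auto
  also have "\<dots> = ennreal ((1 / t) ^ DIM('a)) * emeasure (distr lborel borel T) X"
    using t X by (subst emeasure_density) (auto simp: nn_integral_cmult_indicator)
  also have "emeasure (distr lborel borel T) X = emeasure lborel (T -` X)"
    using X by (subst emeasure_distr) auto
  finally have "ennreal (t ^ DIM('a)) * emeasure lborel X
      = ennreal (t ^ DIM('a) * (1 / t) ^ DIM('a)) * emeasure lborel (T -` X)"
    using t by (simp add: mult.assoc[symmetric] ennreal_mult)
  also have "t ^ DIM('a) * (1 / t) ^ DIM('a) = 1" using t by (simp add: power_one_over)
  finally show ?thesis by (simp add: T)
qed

text \<open>The form in which the inscribed sphere is used: bounding half-spaces with unit normals,
  all at distance \<open>r\<close> from \<open>c\<close>. They are provided by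
  \<open>inscribed_sphere_halfspaces\<close>.\<close>

locale circumscribed =
  fixes U :: "'a::euclidean_space set" and c :: 'a and r :: real and W :: "'a set"
  assumes finU: "finite U" and unit: "u \<in> U \<Longrightarrow> norm u = 1" and r: "r > 0"
    and W_eq: "W = {x. \<forall>u\<in>U. (x - c) \<bullet> u \<le> r}" and bddW: "bounded W"
begin

definition g :: "'a \<Rightarrow> real" where "g x = Max ((\<lambda>u. (x - c) \<bullet> u / r) ` U)"
text \<open>At \<open>c\<close> the quotient is 0 and the value is \<open>c\<close> itself, which is
  not a boundary point; this is why \<open>D\<close> below leaves out \<open>c\<close>.\<close>

definition \<phi> :: "'a \<Rightarrow> 'a" where "\<phi> x = c + (1 / g x) *\<^sub>R (x - c)"

lemma U_nonempty: "U \<noteq> {}"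
  using bddW W_eq not_bounded_UNIV by auto

lemma g_le_iff: "g x \<le> t \<longleftrightarrow> (\<forall>u\<in>U. (x - c) \<bullet> u \<le> r * t)"
  unfolding g_def using finU U_nonempty r by (simp add: divide_le_eq mult.commute)

lemma g_ge: "u \<in> U \<Longrightarrow> (x - c) \<bullet> u \<le> r * g x"
  using g_le_iff[of x "g x"] by simp

lemma g_attained: "\<exists>u\<in>U. (x - c) \<bullet> u = r * g x"
proof -
  have "g x \<in> (\<lambda>u. (x - c) \<bullet> u / r) ` U"
    unfolding g_def using finU U_nonempty by (intro Max_in) auto
  then show ?thesis using r by auto
qed

lemma W_iff: "x \<in> W \<longleftrightarrow> g x \<le> 1"
  by (simp add: W_eq g_le_iff)

lemma g_center [simp]: "g c = 0"
  using g_attained[of c] r by simp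

lemma g_measurable [measurable]: "g \<in> borel_measurable borel"
  unfolding g_def using finU by measurable

lemma \<phi>_measurable [measurable]: "\<phi> \<in> borel_measurable borel"
  unfolding \<phi>_def by measurable

lemma W_borel [measurable]: "W \<in> sets borel"
proof -
  have "{x \<in> space borel. g x \<le> 1} \<in> sets borel" by measurable
  then show ?thesis by (simp add: W_iff[symmetric])
qed

lemma g_scale:
  assumes "t \<ge> 0" shows "g (c + t *\<^sub>R (x - c)) = t * g x"
proof (rule antisym)
  show "g (c + t *\<^sub>R (x - c)) \<le> t * g x"
    using mult_left_mono[OF g_ge[of _ x] assms] by (simp add: g_le_iff mult.left_commute)
  obtain u where "u \<in> U" "(x - c) \<bullet> u = r * g x" using g_attained by blast
  then have "r * (t * g x) \<le> r * g (c + t *\<^sub>R (x - c))"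
    using g_ge[of u "c + t *\<^sub>R (x - c)"] by (simp add: mult_ac)
  then show "t * g x \<le> g (c + t *\<^sub>R (x - c))" using r by simp
qed

text \<open>Otherwise the whole ray from \<open>c\<close> through \<open>x\<close> would lie in
  \<open>W\<close>, against boundedness.\<close>

lemma g_pos:
  assumes "x \<noteq> c" shows "g x > 0"
proof (rule ccontr)
  assume "\<not> g x > 0"
  then have "g (c + t *\<^sub>R (x - c)) \<le> 1" if "t \<ge> 0" for t
    using that by (simp add: g_scale mult_le_0_iff order_trans[of _ 0 1])
  then have "c + t *\<^sub>R (x - c) \<in> W" if "t \<ge> 0" for t using that by (simp add: W_iff)
  moreover obtain R where R: "\<And>y. y \<in> W \<Longrightarrow> dist c y \<le> R"
    using bddW by (auto simp: bounded_any_center[of W c])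
  ultimately have "t * norm (x - c) \<le> R" if "t \<ge> 0" for t
    using that by (fastforce simp: dist_norm)
  from this[of "(\<bar>R\<bar> + 1) / norm (x - c)"] assms show False by simp
qed

lemma g_\<phi>: "x \<noteq> c \<Longrightarrow> g (\<phi> x) = 1"
  using g_pos[of x] by (simp add: \<phi>_def g_scale)

text \<open>Around an interior point there is room to move outwards from \<open>c\<close>, which
  multiplies \<open>g\<close> by \<open>1 + s\<close>; hence \<open>g < 1\<close> there. Conversely
  \<open>g < 1\<close> puts the point into finitely many open half-spaces whose intersection lies in
  \<open>W\<close>.\<close>

lemma frontier_W: "frontier W = {x. g x = 1}"
proof -
  have clW: "closed W"
  proof -
    have "W = (\<Inter>u\<in>U. {x. u \<bullet> x \<le> r + c \<bullet> u})"
      by (auto simp: W_eq inner_diff_left inner_commute algebra_simps)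
    then show ?thesis by (auto intro: closed_halfspace_le)
  qed
  have int: "interior W = {x. g x < 1}"
  proof (intro set_eqI iffI)
    fix x assume "x \<in> interior W"
    then obtain e where e: "e > 0" "cball x e \<subseteq> W" by (auto simp: mem_interior_cball)
    show "x \<in> {x. g x < 1}"
    proof (cases "x = c")
      case False
      define s where "s = e / norm (x - c)"
      have s: "s > 0" using e False by (simp add: s_def)
      have "c + (1 + s) *\<^sub>R (x - c) = x + s *\<^sub>R (x - c)" by (simp add: algebra_simps)
      moreover have "norm (s *\<^sub>R (x - c)) = e" using False e by (simp add: s_def)
      ultimately have "c + (1 + s) *\<^sub>R (x - c) \<in> W"
        using e by (intro subsetD[OF e(2)]) (simp add: dist_norm)
      then have "(1 + s) * g x \<le> 1" using s by (simp add: W_iff g_scale)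
      moreover have "s * g x > 0" using s g_pos[OF False] by simp
      ultimately show ?thesis by (simp add: algebra_simps)
    qed simp
  next
    fix x assume x: "x \<in> {x. g x < 1}"
    let ?G = "\<Inter>u\<in>U. {x. u \<bullet> x < r + c \<bullet> u}"
    have "open ?G" using finU by (intro open_INT) (auto intro: open_halfspace_lt)
    moreover have "(x - c) \<bullet> u < r" if "u \<in> U" for u
    proof -
      have "(x - c) \<bullet> u \<le> r * g x" by (rule g_ge[OF that])
      also have "\<dots> < r * 1" using x r by (intro mult_strict_left_mono) auto
      finally show ?thesis by simp
    qed
    then have "x \<in> ?G" by (simp add: inner_diff_left inner_commute algebra_simps)
    moreover have "?G \<subseteq> W"
    proof
      fix y assume y: "y \<in> ?G"
      have "(y - c) \<bullet> u \<le> r" if "u \<in> U" for u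
        using y that by (auto simp: inner_diff_left inner_commute[of y u] less_imp_le algebra_simps)
      then show "y \<in> W" by (simp add: W_eq)
    qed
    ultimately show "x \<in> interior W" by (meson interiorI)
  qed
  show ?thesis
    unfolding frontier_def closure_closed[OF clW] int by (auto simp: W_iff)
qed

lemma frontier_borel [measurable]: "frontier W \<in> sets borel"
  by (intro borel_closed) auto

lemma \<phi>_frontier: "x \<noteq> c \<Longrightarrow> \<phi> x \<in> frontier W"
  by (simp add: frontier_W g_\<phi>)

definition D :: "'a set" where "D = W - {c}"

lemma D_borel [measurable]: "D \<in> sets borel"
  unfolding D_def by measurable

text \<open>Central projection to the hyperplane scales by \<open>r / ((x - c) \<bullet> u)\<close>,
  radial projection by \<open>1 / g x\<close>. The two factors agree as soon as either projected
  point lies in \<open>A\<close>, where both normalizations hold.\<close>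

lemma cone_over_eq:
  assumes u: "u \<in> U" and A: "A \<subseteq> frontier W" "A \<subseteq> {x. (x - c) \<bullet> u = r}"
  shows "cone_over c r u A = D \<inter> \<phi> -` A"
proof (intro set_eqI iffI)
  fix x assume x: "x \<in> cone_over c r u A"
  define t where "t = r / ((x - c) \<bullet> u)"
  have t: "t > 0" and tx: "c + t *\<^sub>R (x - c) \<in> A" and "x \<noteq> c"
    using x r by (auto simp: cone_over_def t_def)
  then have "t * g x = 1" using A(1) by (auto simp: frontier_W g_scale)
  then have t': "t = 1 / g x" by (metis mult_zero_right nonzero_eq_divide_eq zero_neq_one)
  moreover have "t \<ge> 1" using x by (simp add: cone_over_def t_def)
  ultimately have "x \<in> W" using g_pos[OF \<open>x \<noteq> c\<close>] by (simp add: W_iff le_divide_eq)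
  then show "x \<in> D \<inter> \<phi> -` A" using \<open>x \<noteq> c\<close> tx t' by (simp add: D_def \<phi>_def)
next
  fix x assume x: "x \<in> D \<inter> \<phi> -` A"
  then have g: "g x > 0" "g x \<le> 1" by (auto simp: D_def g_pos W_iff)
  have "(\<phi> x - c) \<bullet> u = r" using x A by auto
  moreover have "(\<phi> x - c) \<bullet> u = ((x - c) \<bullet> u) / g x" by (simp add: \<phi>_def)
  ultimately have "(x - c) \<bullet> u = r * g x" using g by (simp add: divide_eq_eq)
  then show "x \<in> cone_over c r u A"
    using x g r by (auto simp: cone_over_def \<phi>_def mult_le_cancel_left1)
qed

text \<open>Induction over the normals strips off the part of \<open>A\<close> in one hyperplane
  \<open>P\<close> and leaves \<open>A - P\<close> to the remaining ones, so points common to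
  several facets are counted once. One constant serves all steps because the cones share the apex
  \<open>c\<close> and the height \<open>r\<close>.\<close>

lemma emeasure_frontier:
  obtains k where "k > 0"
    "\<And>A. A \<in> sets borel \<Longrightarrow> A \<subseteq> frontier W \<Longrightarrow>
      emeasure surface_measure A = ennreal k * emeasure lborel (D \<inter> \<phi> -` A)"
proof -
  let ?H = "surface_measure :: 'a measure"
  obtain k where k: "k > 0" and cone: "\<And>u A. norm u = 1 \<Longrightarrow> A \<in> sets borel \<Longrightarrow>
      A \<subseteq> {x. (x - c) \<bullet> u = r} \<Longrightarrow>
      emeasure ?H A = ennreal k * emeasure lborel (cone_over c r u A)"
    using hausdorff_eq_cone[OF r, of c] by metis
  have "emeasure ?H A = ennreal k * emeasure lborel (D \<inter> \<phi> -` A)"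
    if "A \<in> sets borel" "V \<subseteq> U" "A \<subseteq> {x \<in> frontier W. \<exists>u\<in>V. (x - c) \<bullet> u = r}" for A V
    using finite_subset[OF that(2) finU] that
  proof (induction V arbitrary: A rule: finite_induct)
    case empty
    then have "A = {}" by auto
    then show ?case by simp
  next
    case (insert u V)
    define P where "P = {x. (x - c) \<bullet> u = r}"
    have "{x \<in> space borel. (x - c) \<bullet> u = r} \<in> sets borel" by measurable
    then have [measurable]: "P \<in> sets borel" by (simp add: P_def)
    note [measurable] = insert.prems(1)
    have sets: "D \<inter> \<phi> -` X \<in> sets lborel" if "X \<in> sets borel" for X
      using measurable_sets[OF \<phi>_measurable that] by simp
    have "emeasure ?H A = emeasure ?H (A \<inter> P) + emeasure ?H (A - P)"
      by (subst plus_emeasure) (auto simp: Int_Diff_Un)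
    also have "emeasure ?H (A \<inter> P) = ennreal k * emeasure lborel (D \<inter> \<phi> -` (A \<inter> P))"
    proof -
      have "cone_over c r u (A \<inter> P) = D \<inter> \<phi> -` (A \<inter> P)"
        using insert.prems by (intro cone_over_eq) (auto simp: P_def)
      moreover have "emeasure ?H (A \<inter> P) = ennreal k * emeasure lborel (cone_over c r u (A \<inter> P))"
        using insert.prems by (intro cone) (auto simp: unit, auto simp: P_def)
      ultimately show ?thesis by simp
    qed
    also have "emeasure ?H (A - P) = ennreal k * emeasure lborel (D \<inter> \<phi> -` (A - P))"
      using insert.prems by (intro insert.IH) (auto, auto simp: P_def)
    also have "ennreal k * emeasure lborel (D \<inter> \<phi> -` (A \<inter> P)) + ennreal k * emeasure lborel (D \<inter> \<phi> -` (A - P))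
        = ennreal k * (emeasure lborel (D \<inter> \<phi> -` (A \<inter> P)) + emeasure lborel (D \<inter> \<phi> -` (A - P)))"
      by (simp add: distrib_left)
    also have "emeasure lborel (D \<inter> \<phi> -` (A \<inter> P)) + emeasure lborel (D \<inter> \<phi> -` (A - P))
        = emeasure lborel (D \<inter> \<phi> -` A)"
      by (subst plus_emeasure) (auto intro!: sets arg_cong[of _ _ "emeasure lborel"])
    finally show ?case .
  qed
  moreover have "A \<subseteq> {x \<in> frontier W. \<exists>u\<in>U. (x - c) \<bullet> u = r}" if "A \<subseteq> frontier W" for A
  proof
    fix x assume "x \<in> A"
    then have "x \<in> frontier W" using that by blast
    moreover from this have "g x = 1" by (simp add: frontier_W)
    ultimately show "x \<in> {x \<in> frontier W. \<exists>u\<in>U. (x - c) \<bullet> u = r}"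
      using g_attained[of x] by simp
  qed
  ultimately show thesis using k by (intro that[of k]) blast+
qed

text \<open>The uniform distribution on the body up to normalization; averages are formed by
  dividing by \<open>measure \<mu> UNIV\<close>.\<close>

definition \<mu> :: "'a measure" where "\<mu> = density lborel (indicator D)"

lemma sets_\<mu> [simp, measurable_cong]: "sets \<mu> = sets borel" and space_\<mu> [simp]: "space \<mu> = UNIV"
  by (simp_all add: \<mu>_def)

lemma emeasure_\<mu>: "A \<in> sets borel \<Longrightarrow> emeasure \<mu> A = emeasure lborel (D \<inter> A)"
  unfolding \<mu>_def
  by (subst emeasure_density)
    (auto simp: nn_integral_indicator[symmetric] indicator_inter_arith[symmetric] simp del: nn_integral_indicator)

lemma finite_measure_\<mu>: "finite_measure \<mu>"
proof
  have "bounded D" using bddW by (rule bounded_subset) (auto simp: D_def)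
  then have "emeasure lborel D < \<infinity>" by (rule emeasure_bounded_finite)
  then show "emeasure \<mu> (space \<mu>) \<noteq> \<infinity>" by (simp add: emeasure_\<mu>)
qed

lemma AE_\<mu>: "AE x in \<mu>. x \<in> D"
  unfolding \<mu>_def by (subst AE_density) (auto simp: indicator_def)

text \<open>Surface measure restricted to the boundary equals \<open>k\<close> times the image of
  \<open>\<mu>\<close> under \<open>\<phi>\<close>. The values may be vectors, so that the identity
  function yields the center of mass.\<close>

lemma average_frontier:
  fixes F :: "'a \<Rightarrow> 'b::{banach, second_countable_topology}"
  assumes [measurable]: "F \<in> borel_measurable borel"
  shows "(1 / measure surface_measure (frontier W)) *\<^sub>R (LINT x:frontier W|surface_measure. F x)
    = (1 / measure \<mu> UNIV) *\<^sub>R (\<integral>x. F (\<phi> x) \<partial>\<mu>)"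
proof -
  let ?H = "surface_measure :: 'a measure"
  obtain k where k: "k > 0" and eq: "\<And>A. A \<in> sets borel \<Longrightarrow> A \<subseteq> frontier W \<Longrightarrow>
      emeasure ?H A = ennreal k * emeasure lborel (D \<inter> \<phi> -` A)"
    using emeasure_frontier by metis
  have pre: "\<phi> -` A \<in> sets borel" if "A \<in> sets borel" for A
    using measurable_sets[OF \<phi>_measurable that] by simp
  have fr: "D \<inter> \<phi> -` (frontier W \<inter> A) = D \<inter> \<phi> -` A" for A
    using \<phi>_frontier by (auto simp: D_def)
  have M: "density ?H (\<lambda>x. ennreal (indicator (frontier W) x)) = density (distr \<mu> borel \<phi>) (\<lambda>_. ennreal k)"
  proof (rule measure_eqI)
    fix A assume "A \<in> sets (density ?H (\<lambda>x. ennreal (indicator (frontier W) x)))"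
    then have A: "A \<in> sets borel" by simp
    have "emeasure (density ?H (\<lambda>x. ennreal (indicator (frontier W) x))) A = emeasure ?H (frontier W \<inter> A)"
      using A by (subst emeasure_density)
        (auto simp: ennreal_indicator nn_integral_indicator[symmetric] indicator_inter_arith[symmetric]
          simp del: nn_integral_indicator)
    also have "\<dots> = ennreal k * emeasure lborel (D \<inter> \<phi> -` A)"
      using A fr[of A] by (subst eq) auto
    also have "\<dots> = ennreal k * emeasure (distr \<mu> borel \<phi>) A"
      using A pre[OF A] by (subst emeasure_distr) (auto simp: emeasure_\<mu>)
    also have "\<dots> = emeasure (density (distr \<mu> borel \<phi>) (\<lambda>_. ennreal k)) A"
      using A by (subst emeasure_density) (auto simp: nn_integral_cmult_indicator)
    finally show "emeasure (density ?H (\<lambda>x. ennreal (indicator (frontier W) x))) A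
        = emeasure (density (distr \<mu> borel \<phi>) (\<lambda>_. ennreal k)) A" .
  qed simp
  have "emeasure ?H (frontier W) = ennreal k * emeasure \<mu> UNIV"
    using fr[of UNIV] by (subst eq) (auto simp: emeasure_\<mu>)
  then have "measure ?H (frontier W) = k * measure \<mu> UNIV"
    using k by (simp add: measure_def enn2real_mult)
  moreover have "(LINT x:frontier W|?H. F x) = k *\<^sub>R (\<integral>x. F (\<phi> x) \<partial>\<mu>)"
  proof -
    have "(LINT x:frontier W|?H. F x) = integral\<^sup>L (density ?H (\<lambda>x. ennreal (indicator (frontier W) x))) F"
      unfolding set_lebesgue_integral_def by (subst integral_density) auto
    also have "\<dots> = (\<integral>x. k *\<^sub>R F x \<partial>distr \<mu> borel \<phi>)"
      unfolding M using k by (subst integral_density) auto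
    also have "\<dots> = (\<integral>x. k *\<^sub>R F (\<phi> x) \<partial>\<mu>)"
      by (rule integral_distr) measurable
    finally show ?thesis by simp
  qed
  ultimately show ?thesis using k by simp
qed

text \<open>The gauge and the radial projection are independent under the uniform distribution on the body.\<close>

lemma integral_gauge:
  obtains \<gamma> where "0 \<le> \<gamma>" "\<gamma> \<le> 1"
    "\<And>F :: 'a \<Rightarrow> real. F \<in> borel_measurable borel \<Longrightarrow>
      (\<integral>x. g x * F (\<phi> x) \<partial>\<mu>) = \<gamma> * (\<integral>x. F (\<phi> x) \<partial>\<mu>)"
proof -
  interpret finite_measure \<mu> by (rule finite_measure_\<mu>)
  \<comment> \<open>The layer-cake formula for the mean of \<open>g\<close>: the integrand is the
    fraction of the body where \<open>g\<close> exceeds \<open>t\<close>.\<close>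
  define C where "C = (\<integral>\<^sup>+t. ennreal (1 - t ^ DIM('a)) * indicator {0<..<1} t \<partial>lborel)"
  have "C \<le> (\<integral>\<^sup>+t. indicator {0<..<1::real} t \<partial>lborel)"
    unfolding C_def by (intro nn_integral_mono) (auto simp: indicator_def intro!: ennreal_le_1[THEN iffD2])
  then have C1: "C \<le> 1" by simp
  define \<gamma> where "\<gamma> = enn2real C"
  have \<gamma>: "0 \<le> \<gamma>" "\<gamma> \<le> 1" and C\<gamma>: "C = ennreal \<gamma>"
    using C1 enn2real_mono[of C 1] le_less_trans[OF C1, of top] by (auto simp: \<gamma>_def)
  have pre: "\<phi> -` A \<in> sets borel" if "A \<in> sets borel" for A
    using measurable_sets[OF \<phi>_measurable that] by simp
  have level: "emeasure \<mu> {x \<in> \<phi> -` A. t < g x} = ennreal (1 - t ^ DIM('a)) * emeasure \<mu> (\<phi> -` A)"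
    if A: "A \<in> sets borel" and t: "0 < t" "t < 1" for A t
  proof -
    have [measurable]: "\<phi> -` A \<in> sets borel" by (rule pre[OF A])
    have "{x \<in> space borel. x \<in> \<phi> -` A \<and> t < g x} \<in> sets borel" by measurable
    then have m1: "{x \<in> \<phi> -` A. t < g x} \<in> sets borel" by simp
    have "{x \<in> space borel. x \<in> \<phi> -` A \<and> g x \<le> t} \<in> sets borel" by measurable
    then have m2: "{x \<in> \<phi> -` A. g x \<le> t} \<in> sets borel" by simp
    \<comment> \<open>The homothety does not change \<open>\<phi>\<close>, which is constant on rays
      from \<open>c\<close>, and it divides \<open>g\<close> by \<open>t\<close>.\<close>
    have "D \<inter> {x \<in> \<phi> -` A. g x \<le> t} = (\<lambda>x. c + (1 / t) *\<^sub>R (x - c)) -` (D \<inter> \<phi> -` A)"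
    proof (intro set_eqI)
      fix x
      have gs: "g (c + (1 / t) *\<^sub>R (x - c)) = g x / t" using t by (simp add: g_scale)
      have "\<phi> (c + (1 / t) *\<^sub>R (x - c)) = \<phi> x"
        using t unfolding \<phi>_def gs by simp
      moreover have "g x \<le> 1" if "g x \<le> t" using that t by simp
      ultimately show "x \<in> D \<inter> {x \<in> \<phi> -` A. g x \<le> t} \<longleftrightarrow>
          x \<in> (\<lambda>x. c + (1 / t) *\<^sub>R (x - c)) -` (D \<inter> \<phi> -` A)"
        using t by (auto simp: D_def W_iff gs divide_le_eq)
    qed
    then have "emeasure \<mu> {x \<in> \<phi> -` A. g x \<le> t} = ennreal (t ^ DIM('a)) * emeasure \<mu> (\<phi> -` A)"
      using emeasure_lborel_vimage_homothety[OF t(1), of "D \<inter> \<phi> -` A" c] m2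
      by (simp add: emeasure_\<mu>)
    moreover have "emeasure \<mu> (\<phi> -` A) = emeasure \<mu> {x \<in> \<phi> -` A. g x \<le> t} + emeasure \<mu> {x \<in> \<phi> -` A. t < g x}"
      using m1 m2 by (subst plus_emeasure) (auto intro!: arg_cong[of _ _ "emeasure \<mu>"])
    ultimately have "measure \<mu> {x \<in> \<phi> -` A. t < g x} = (1 - t ^ DIM('a)) * measure \<mu> (\<phi> -` A)"
      using t by (simp add: emeasure_eq_measure ennreal_mult[symmetric] ennreal_plus[symmetric] algebra_simps del: ennreal_plus)
    then show ?thesis
      using t by (simp add: emeasure_eq_measure ennreal_mult power_le_one)
  qed
  have cake: "(\<integral>\<^sup>+x. ennreal (g x) * indicator (\<phi> -` A) x \<partial>\<mu>) = C * emeasure \<mu> (\<phi> -` A)"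
    if A: "A \<in> sets borel" for A
  proof -
    interpret P: pair_sigma_finite \<mu> "lborel :: real measure" ..
    have [measurable]: "\<phi> -` A \<in> sets borel" by (rule pre[OF A])
    \<comment> \<open>The region below the graph of \<open>g\<close>. Cutting at height 1 loses
      nothing on \<open>D\<close>, where \<open>g \<le> 1\<close>, and confines \<open>t\<close> to
      the range covered by \<open>level\<close>.\<close>
    define E where "E = {p. fst p \<in> \<phi> -` A \<and> 0 < snd p \<and> snd p < 1 \<and> snd p < g (fst p)}"
    have "{p \<in> space (\<mu> \<Otimes>\<^sub>M lborel). fst p \<in> \<phi> -` A \<and> 0 < snd p \<and> snd p < 1 \<and> snd p < g (fst p)}
        \<in> sets (\<mu> \<Otimes>\<^sub>M lborel)"
      by measurable
    then have E: "E \<in> sets (\<mu> \<Otimes>\<^sub>M lborel)" by (simp add: E_def space_pair_measure)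
    have "(\<integral>\<^sup>+x. ennreal (g x) * indicator (\<phi> -` A) x \<partial>\<mu>) = (\<integral>\<^sup>+x. emeasure lborel (Pair x -` E) \<partial>\<mu>)"
    proof (rule nn_integral_cong_AE, use AE_\<mu> in eventually_elim)
      fix x assume "x \<in> D"
      then have "0 < g x" "g x \<le> 1" by (auto simp: D_def g_pos W_iff)
      moreover from this have "Pair x -` E = (if x \<in> \<phi> -` A then {0<..<g x} else {})"
        by (auto simp: E_def)
      ultimately show "ennreal (g x) * indicator (\<phi> -` A) x = emeasure lborel (Pair x -` E)"
        by auto
    qed
    also have "\<dots> = emeasure (\<mu> \<Otimes>\<^sub>M lborel) E"
      by (rule lborel.emeasure_pair_measure_alt[OF E, symmetric])
    also have "\<dots> = (\<integral>\<^sup>+t. emeasure \<mu> ((\<lambda>x. (x, t)) -` E) \<partial>lborel)"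
      by (rule P.emeasure_pair_measure_alt2[OF E])
    also have "\<dots> = (\<integral>\<^sup>+t. (ennreal (1 - t ^ DIM('a)) * indicator {0<..<1} t) * emeasure \<mu> (\<phi> -` A) \<partial>lborel)"
    proof (rule nn_integral_cong)
      fix t :: real
      have "(\<lambda>x. (x, t)) -` E = (if 0 < t \<and> t < 1 then {x \<in> \<phi> -` A. t < g x} else {})"
        by (auto simp: E_def)
      then show "emeasure \<mu> ((\<lambda>x. (x, t)) -` E)
          = (ennreal (1 - t ^ DIM('a)) * indicator {0<..<1} t) * emeasure \<mu> (\<phi> -` A)"
        using level[OF A, of t] by (auto simp: indicator_def)
    qed
    also have "\<dots> = C * emeasure \<mu> (\<phi> -` A)"
      unfolding C_def by (rule nn_integral_multc) measurable
    finally show ?thesis .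
  qed
  have g0: "AE x in \<mu>. 0 \<le> g x"
    using AE_\<mu> by eventually_elim (auto simp: D_def less_imp_le[OF g_pos])
  have M: "distr (density \<mu> (\<lambda>x. ennreal (g x))) borel \<phi> = density (distr \<mu> borel \<phi>) (\<lambda>_. ennreal \<gamma>)"
  proof (rule measure_eqI)
    fix A assume "A \<in> sets (distr (density \<mu> (\<lambda>x. ennreal (g x))) borel \<phi>)"
    then have A: "A \<in> sets borel" by simp
    have "emeasure (distr (density \<mu> (\<lambda>x. ennreal (g x))) borel \<phi>) A
        = (\<integral>\<^sup>+x. ennreal (g x) * indicator (\<phi> -` A) x \<partial>\<mu>)"
      using A pre[OF A] by (subst emeasure_distr) (auto simp: emeasure_density)
    also have "\<dots> = ennreal \<gamma> * emeasure (distr \<mu> borel \<phi>) A"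
      using A pre[OF A] unfolding cake[OF A] C\<gamma> by (subst emeasure_distr) auto
    also have "\<dots> = emeasure (density (distr \<mu> borel \<phi>) (\<lambda>_. ennreal \<gamma>)) A"
      using A by (subst emeasure_density) (auto simp: nn_integral_cmult_indicator)
    finally show "emeasure (distr (density \<mu> (\<lambda>x. ennreal (g x))) borel \<phi>) A
        = emeasure (density (distr \<mu> borel \<phi>) (\<lambda>_. ennreal \<gamma>)) A" .
  qed simp
  show thesis
  proof (rule that[OF \<gamma>])
    fix F :: "'a \<Rightarrow> real" assume F[measurable]: "F \<in> borel_measurable borel"
    have "(\<integral>x. g x * F (\<phi> x) \<partial>\<mu>) = (\<integral>x. F (\<phi> x) \<partial>density \<mu> (\<lambda>x. ennreal (g x)))"
      using g0 by (subst integral_density) auto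
    also have "\<dots> = integral\<^sup>L (distr (density \<mu> (\<lambda>x. ennreal (g x))) borel \<phi>) F"
      by (rule integral_distr[symmetric]) measurable
    also have "\<dots> = (\<integral>x. \<gamma> * F x \<partial>distr \<mu> borel \<phi>)"
      unfolding M using \<gamma> by (subst integral_density) auto
    also have "\<dots> = (\<integral>x. \<gamma> * F (\<phi> x) \<partial>\<mu>)"
      by (rule integral_distr) measurable
    finally show "(\<integral>x. g x * F (\<phi> x) \<partial>\<mu>) = \<gamma> * (\<integral>x. F (\<phi> x) \<partial>\<mu>)" by simp
  qed
qed

end

section \<open>From the inscribed sphere to half-spaces at equal distance\<close>

lemma orthogonal_imp_parallel:
  fixes a w :: "'a::real_inner"
  assumes "\<And>y. w \<bullet> y = 0 \<Longrightarrow> a \<bullet> y = 0"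
  shows "a = (a \<bullet> w / (w \<bullet> w)) *\<^sub>R w"
proof -
  define y where "y = a - (a \<bullet> w / (w \<bullet> w)) *\<^sub>R w"
  have "w \<bullet> y = 0"
    by (cases "w = 0") (auto simp: y_def inner_diff_right inner_commute)
  then have "y \<bullet> y = 0"
    using assms[of y] by (subst (1) y_def) (simp add: inner_diff_left)
  then show ?thesis by (simp add: y_def)
qed

text \<open>In a minimal representation of \<open>W\<close> each half-space carries a facet.
  Tangency makes the hyperplane of that facet the tangent hyperplane at a point \<open>p\<close> of
  the sphere, so the normal is parallel to \<open>p - c\<close>.\<close>

lemma inscribed_sphere_halfspaces:
  fixes W :: "'a::euclidean_space set"
  assumes "polytope W" "interior W \<noteq> {}" "inscribed_sphere c r W"
  obtains U where "finite U" "\<And>u. u \<in> U \<Longrightarrow> norm u = 1" "W = {x. \<forall>u\<in>U. (x - c) \<bullet> u \<le> r}"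
proof -
  have r: "r > 0" and sph: "sphere c r \<subseteq> W"
    and tan: "\<And>F. F facet_of W \<Longrightarrow> sphere_tangent_to c r F"
    using assms(3) by (auto simp: inscribed_sphere_def)
  have "convex W" using assms(1) by (rule polytope_imp_convex)
  obtain e :: 'a where "e \<in> Basis" using nonempty_Basis by blast
  \<comment> \<open>The center is the midpoint of two antipodal points of the sphere, which lie in
    \<open>W\<close>.\<close>
  then have "c + r *\<^sub>R e \<in> W" "c - r *\<^sub>R e \<in> W"
    using sph r by (auto simp: dist_norm)
  then have "(1 / 2) *\<^sub>R (c + r *\<^sub>R e) + (1 / 2) *\<^sub>R (c - r *\<^sub>R e) \<in> W"
    using \<open>convex W\<close> by (intro convexD) auto
  then have c: "c \<in> W" by (simp add: algebra_simps flip: scaleR_add_left)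
  obtain F where F: "finite F" and seq: "W = affine hull W \<inter> \<Inter>F"
    and faces: "\<And>h. h \<in> F \<Longrightarrow> \<exists>a b. a \<noteq> 0 \<and> h = {x. a \<bullet> x \<le> b}"
    and min: "\<And>F'. F' \<subset> F \<Longrightarrow> W \<subset> (affine hull W) \<inter> \<Inter>F'"
    using polytope_imp_polyhedron[OF assms(1)] by (simp add: polyhedron_Int_affine_minimal) meson
  then obtain a b where ab: "\<And>h. h \<in> F \<Longrightarrow> a h \<noteq> 0 \<and> h = {x. a h \<bullet> x \<le> b h}"
    by metis
  have "affine hull W = UNIV" using assms(2) by (rule affine_hull_nonempty_interior)
  then have WF: "W = \<Inter>F" using seq by auto
  have "\<exists>u. norm u = 1 \<and> h = {x. (x - c) \<bullet> u \<le> r}" if h: "h \<in> F" for h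
  proof -
    let ?C = "W \<inter> {x. a h \<bullet> x = b h}"
    have "?C facet_of W"
      using facet_of_polyhedron_explicit[OF F seq ab min] h by blast
    from tan[OF this] obtain p where p: "p \<in> ?C" "dist c p = r"
      and aff: "affine hull ?C = {x. (p - c) \<bullet> (x - p) = 0}"
      by (auto simp: sphere_tangent_to_def)
    define w where "w = p - c"
    have w: "norm w = r" using p by (simp add: w_def dist_norm norm_minus_commute)
    then have ww: "w \<bullet> w = r\<^sup>2" by (simp add: dot_square_norm)
    have "affine hull ?C \<subseteq> {x. a h \<bullet> x = b h}"
      by (rule hull_minimal) (auto intro: affine_hyperplane)
    then have sub: "a h \<bullet> x = b h" if "w \<bullet> (x - p) = 0" for x
      using that aff by (auto simp: w_def)
    have "a h \<bullet> y = 0" if "w \<bullet> y = 0" for y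
      using sub[of "p + y"] sub[of p] that by (simp add: inner_add_right)
    then obtain l where al: "a h = l *\<^sub>R w"
      using orthogonal_imp_parallel[of w "a h"] by blast
    \<comment> \<open>Only the line of the normal is known so far; that \<open>c\<close> lies on the
      inner side of the hyperplane makes the normal point along \<open>w\<close>, not against
      it.\<close>
    have "a h \<bullet> c \<le> a h \<bullet> p" using c WF h ab[OF h] sub[of p] by auto
    then have "0 \<le> l * (w \<bullet> w)" by (simp add: al w_def inner_diff_right right_diff_distrib)
    moreover have "l \<noteq> 0" using ab[OF h] al by auto
    ultimately have l: "l > 0" using r by (simp add: ww zero_le_mult_iff)
    have "x \<in> h \<longleftrightarrow> (x - c) \<bullet> ((1 / r) *\<^sub>R w) \<le> r" for x
    proof -
      have "x \<in> h \<longleftrightarrow> l * (w \<bullet> x) \<le> l * (w \<bullet> p)"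
        using ab[OF h] sub[of p] al by auto
      also have "\<dots> \<longleftrightarrow> w \<bullet> x \<le> w \<bullet> p" using l by simp
      also have "\<dots> \<longleftrightarrow> w \<bullet> (x - c) \<le> w \<bullet> w" by (simp add: w_def inner_diff_right)
      also have "\<dots> \<longleftrightarrow> (x - c) \<bullet> ((1 / r) *\<^sub>R w) \<le> r"
        using r by (simp add: ww inner_commute field_simps power2_eq_square)
      finally show ?thesis .
    qed
    moreover have "norm ((1 / r) *\<^sub>R w) = 1" using w r by simp
    ultimately show ?thesis by blast
  qed
  then obtain u where u: "\<And>h. h \<in> F \<Longrightarrow> norm (u h) = 1 \<and> h = {x. (x - c) \<bullet> u h \<le> r}"
    by metis
  show thesis
  proof (rule that[of "u ` F"])
    show "W = {x. \<forall>v\<in>u ` F. (x - c) \<bullet> v \<le> r}"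
      using u unfolding WF by blast
  qed (use F u in auto)
qed

section \<open>Convex functions on polytopes\<close>

text \<open>A hyperplane separates the epigraph from the open vertical ray below
  \<open>(c, f c)\<close>. It is the graph of the wanted affine minorant, provided that it is not
  vertical.\<close>

lemma convex_on_subgradient:
  fixes f :: "'a::euclidean_space \<Rightarrow> real"
  assumes f: "convex_on W f" and c: "c \<in> interior W"
  obtains a where "\<And>x. x \<in> W \<Longrightarrow> f c + a \<bullet> (x - c) \<le> f x"
proof -
  have W: "convex W" using f by (rule convex_on_imp_convex)
  have cW: "c \<in> W" using c interior_subset by blast
  have "convex (epigraph W f)" using f W by (simp add: convex_epigraph)
  moreover have "convex ({c} \<times> {..<f c})" by (intro convex_Times) auto
  moreover have "epigraph W f \<noteq> {}" using cW by (auto simp: epigraph_def)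
  moreover have "{c} \<times> {..<f c} \<noteq> {}" using lt_ex[of "f c"] by auto
  moreover have "{c} \<times> {..<f c} \<inter> epigraph W f = {}" by (auto simp: epigraph_def)
  ultimately obtain p \<beta> where p: "p \<noteq> 0" and lo: "\<And>z. z \<in> {c} \<times> {..<f c} \<Longrightarrow> p \<bullet> z \<le> \<beta>"
    and up: "\<And>z. z \<in> epigraph W f \<Longrightarrow> \<beta> \<le> p \<bullet> z"
    using separating_hyperplane_sets[of "{c} \<times> {..<f c}" "epigraph W f"] by blast
  obtain q s where pq: "p = (q, s)" by (cases p)
  have lo: "q \<bullet> c + s * t \<le> \<beta>" if "t < f c" for t
    using lo[of "(c, t)"] that by (simp add: pq)
  have up: "\<beta> \<le> q \<bullet> x + s * t" if "x \<in> W" "f x \<le> t" for x t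
    using up[of "(x, t)"] that by (simp add: pq epigraph_def)
  have "s \<ge> 0"
    using lo[of "f c - 1"] up[OF cW, of "f c"] by (simp add: algebra_simps)
  \<comment> \<open>A vertical hyperplane would make \<open>c\<close> minimize a nonzero linear
    functional over \<open>W\<close>, which is impossible at an interior point.\<close>
  moreover have "s \<noteq> 0"
  proof
    assume s: "s = 0"
    then have q: "q \<noteq> 0" using p pq by (auto simp: zero_prod_def)
    obtain e where e: "e > 0" "cball c e \<subseteq> W" using c by (auto simp: mem_interior_cball)
    define x where "x = c - (e / norm q) *\<^sub>R q"
    have "x \<in> W" using e q by (intro subsetD[OF e(2)]) (simp add: x_def dist_norm)
    then have "q \<bullet> c \<le> q \<bullet> x" using up[of x "f x"] lo[of "f c - 1"] s by simp
    moreover have "e * (q \<bullet> q) / norm q > 0" using e q by simp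
    ultimately show False by (simp add: x_def inner_diff_right)
  qed
  ultimately have s: "s > 0" by simp
  have key: "q \<bullet> c + s * f c \<le> \<beta>"
  proof (rule ccontr)
    assume nle: "\<not> q \<bullet> c + s * f c \<le> \<beta>"
    \<comment> \<open>Half of the excess over \<open>\<beta>\<close>, divided by \<open>s\<close>:
      lowering \<open>f c\<close> by \<open>d\<close> still leaves a value above
      \<open>\<beta>\<close>.\<close>
    define d where "d = (q \<bullet> c + s * f c - \<beta>) / (2 * s)"
    have sd: "2 * (s * d) = q \<bullet> c + s * f c - \<beta>" using s by (simp add: d_def)
    have "d > 0" using nle s by (simp add: d_def)
    then have "q \<bullet> c + s * (f c - d) \<le> \<beta>" by (intro lo) simp
    then show False using sd nle by (simp add: right_diff_distrib)
  qed
  show thesis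
  proof (rule that[of "- (1 / s) *\<^sub>R q"])
    fix x assume "x \<in> W"
    then have "q \<bullet> c + s * f c \<le> q \<bullet> x + s * f x" using key up[of x "f x"] by simp
    then show "f c + (- (1 / s) *\<^sub>R q) \<bullet> (x - c) \<le> f x"
      using s by (simp add: inner_diff_right field_simps)
  qed
qed

text \<open>The values at the vertices bound \<open>f\<close> from above; an affine minorant,
  bounded on the bounded set \<open>W\<close>, bounds it from below.\<close>

lemma convex_on_polytope_bounded:
  fixes f :: "'a::euclidean_space \<Rightarrow> real"
  assumes W: "polytope W" and f: "convex_on W f" and c: "c \<in> interior W"
  obtains B where "\<And>x. x \<in> W \<Longrightarrow> \<bar>f x\<bar> \<le> B"
proof -
  obtain V where V: "finite V" "W = convex hull V" using W by (auto simp: polytope_def)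
  define B1 where "B1 = Max (insert 0 (f ` V))"
  have "\<forall>x\<in>V. f x \<le> B1" using V(1) by (auto simp: B1_def)
  then have up: "f x \<le> B1" if "x \<in> W" for x
    using convex_on_convex_hull_bound[of V f B1] f V(2) that by auto
  obtain a where a: "\<And>x. x \<in> W \<Longrightarrow> f c + a \<bullet> (x - c) \<le> f x"
    using convex_on_subgradient[OF f c] by blast
  obtain R where R: "\<And>x. x \<in> W \<Longrightarrow> dist c x \<le> R"
    using polytope_imp_bounded[OF W] by (auto simp: bounded_any_center[of W c])
  have lo: "f c - norm a * R \<le> f x" if "x \<in> W" for x
  proof -
    have "\<bar>a \<bullet> (x - c)\<bar> \<le> norm a * norm (x - c)" by (rule Cauchy_Schwarz_ineq2)
    also have "\<dots> \<le> norm a * R"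
      using R[OF that] by (intro mult_left_mono) (auto simp: dist_norm norm_minus_commute)
    finally show ?thesis using a[OF that] by linarith
  qed
  show thesis
    by (rule that[of "max B1 (norm a * R - f c)"]) (use up lo in \<open>force simp: abs_le_iff\<close>)
qed

text \<open>Composing with an affine projection onto the affine hull reduces to the case of an open domain.\<close>

lemma convex_on_continuous_rel_interior:
  fixes f :: "'a::euclidean_space \<Rightarrow> real"
  assumes f: "convex_on S f"
  shows "continuous_on (rel_interior S) f"
proof (cases "S = {}")
  case False
  then obtain z where z: "z \<in> affine hull S" by (meson all_not_in_conv hull_inc)
  define V where "V = (\<lambda>x. x - z) ` (affine hull S)"
  have V: "subspace V"
    unfolding V_def using affine_diffs_subspace_subtract[OF affine_affine_hull z] by (simp add: image_def) 
  have convS: "convex S" using f by (rule convex_on_imp_convex)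
  obtain g :: "'a \<Rightarrow> 'a" where g: "linear g" "range g \<subseteq> V" "\<And>x. x \<in> V \<Longrightarrow> g x = x"
    using linear_exists_left_inverse_on[OF linear_ident V] by auto
  define p where "p x = z + g (x - z)" for x
  have p: "p x \<in> affine hull S" for x
  proof -
    have "g (x - z) \<in> V" using g(2) by blast
    then show ?thesis by (auto simp: p_def V_def)
  qed
  have pid: "p x = x" if "x \<in> affine hull S" for x
    using g(3)[of "x - z"] that by (simp add: p_def V_def)
  have contp: "continuous_on A p" for A
    unfolding p_def using g(1)
    by (intro continuous_intros linear_continuous_on_compose[where g = g]) 
  have paff: "p (u *\<^sub>R x + v *\<^sub>R y) = u *\<^sub>R p x + v *\<^sub>R p y" if "u + v = 1" for u v x y
  proof -
    have z: "u *\<^sub>R w + v *\<^sub>R w = w" for w :: 'a using that by (simp flip: scaleR_add_left)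
    have "u *\<^sub>R x + v *\<^sub>R y - z = u *\<^sub>R (x - z) + v *\<^sub>R (y - z)"
      using z[of z] by (simp add: algebra_simps)
    then show ?thesis
      using z[of z] by (simp add: p_def linear_add[OF g(1)] linear_scale[OF g(1)] scaleR_add_right)
  qed
  define G where "G = p -` rel_interior S"
  have "open G"
  proof -
    obtain T where T: "open T" "rel_interior S = affine hull S \<inter> T"
      using openin_rel_interior[of S] by (auto simp: openin_open)
    then have "G = p -` T" using p by (auto simp: G_def)
    then show ?thesis using T contp[of UNIV] by (simp add: open_vimage)
  qed
  moreover have "convex_on G (f \<circ> p)"
  proof (rule convex_onI)
    have cri: "convex (rel_interior S)" using convS by (rule convex_rel_interior)
    show "convex G"
      unfolding convex_def G_def using cri by (auto simp: paff convex_def)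
    fix t x y assume t: "0 < t" "t < (1::real)" and xy: "x \<in> G" "y \<in> G"
    then have "p x \<in> S" "p y \<in> S" using rel_interior_subset by (auto simp: G_def)
    then show "(f \<circ> p) ((1 - t) *\<^sub>R x + t *\<^sub>R y) \<le> (1 - t) * (f \<circ> p) x + t * (f \<circ> p) y"
      using t convex_onD[OF f, of t "p x" "p y"] by (simp add: paff)
  qed
  ultimately have "continuous_on G (f \<circ> p)" by (rule convex_on_continuous)
  moreover have ri: "p x = x" if "x \<in> rel_interior S" for x
    using that rel_interior_subset[of S] hull_subset[of S affine] by (intro pid) blast
  then have "rel_interior S \<subseteq> G" by (auto simp: G_def)
  ultimately have "continuous_on (rel_interior S) (f \<circ> p)" by (rule continuous_on_subset)
  then show ?thesis
    by (rule continuous_on_eq) (simp add: ri)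
qed simp

lemma rel_interior_borel:
  fixes S :: "'a::euclidean_space set"
  shows "rel_interior S \<in> sets borel"
proof -
  obtain T where "open T" "rel_interior S = affine hull S \<inter> T"
    using openin_rel_interior[of S] by (auto simp: openin_open)
  then show ?thesis by (simp add: borel_closed)
qed

text \<open>A point of \<open>W\<close> off the relative interior lies in a facet, which is a
  polyhedron of smaller dimension, and faces of a facet are faces of \<open>W\<close>.\<close>

lemma polyhedron_in_rel_interior_face:
  fixes W :: "'a::euclidean_space set"
  assumes "polyhedron W" "x \<in> W"
  shows "\<exists>F. F face_of W \<and> x \<in> rel_interior F"
  using assms
proof (induction "nat (aff_dim W)" arbitrary: W rule: less_induct)
  case less
  have W: "W face_of W" using less.prems polyhedron_imp_convex face_of_refl by blast
  show ?case
  proof (cases "x \<in> rel_interior W")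
    case False
    then have "x \<in> rel_frontier W"
      using less.prems by (simp add: rel_frontier_def closure_subset[THEN subsetD])
    then obtain G where G: "G facet_of W" "x \<in> G"
      using rel_frontier_of_polyhedron[OF less.prems(1)] by auto
    have "polyhedron G"
      using G less.prems by (meson face_of_polyhedron_polyhedron facet_of_imp_face_of)
    moreover have "nat (aff_dim G) < nat (aff_dim W)"
    proof -
      have "aff_dim G = aff_dim W - 1" using G by (simp add: facet_of_def)
      moreover have "\<not> aff_dim G < 0" using G(2) by (auto simp: aff_dim_negative_iff)
      ultimately show ?thesis by simp
    qed
    ultimately obtain F where "F face_of G" "x \<in> rel_interior F"
      using less.hyps[of G] G by blast
    then show ?thesis using G face_of_trans facet_of_imp_face_of by blast
  qed (use W in blast)
qed

text \<open>Jumps of \<open>f\<close> between faces do no harm: the complement of \<open>W\<close>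
  and the relative interiors of its finitely many faces are Borel and cover the space, and the
  function is continuous on each.\<close>

lemma convex_on_polytope_borel_measurable:
  fixes f :: "'a::euclidean_space \<Rightarrow> real"
  assumes W: "polytope W" and f: "convex_on W f"
  shows "(\<lambda>x. indicator W x *\<^sub>R f x) \<in> borel_measurable borel"
proof (rule measurable_piecewise_restrict)
  let ?C = "insert (- W) (rel_interior ` {F. F face_of W})"
  show "countable ?C" using finite_polytope_faces[OF W] by (simp add: countable_finite)
  show "X \<inter> space borel \<in> sets borel" if "X \<in> ?C" for X
    using that polytope_imp_closed[OF W] by (auto simp: rel_interior_borel borel_open open_Compl)
  show "space borel \<subseteq> \<Union> ?C"
    using polyhedron_in_rel_interior_face[OF polytope_imp_polyhedron[OF W]] by fastforce
  fix X assume "X \<in> ?C"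
  then consider "X = - W" | F where "F face_of W" "X = rel_interior F" by blast
  then show "(\<lambda>x. indicator W x *\<^sub>R f x) \<in> borel_measurable (restrict_space borel X)"
  proof cases
    case 1
    then have "(\<lambda>x. 0 :: real) \<in> borel_measurable (restrict_space borel X)" by simp
    then show ?thesis
      by (rule measurable_cong[THEN iffD1, rotated]) (auto simp: 1 space_restrict_space)
  next
    case 2
    have sub: "F \<subseteq> W" using 2 by (simp add: face_of_imp_subset)
    have "convex F" using 2 face_of_imp_convex by blast
    then have "convex_on F f" by (rule convex_on_subset[OF f sub])
    then have "continuous_on X f" using 2 by (simp add: convex_on_continuous_rel_interior)
    then have "f \<in> borel_measurable (restrict_space borel X)"
      by (rule borel_measurable_continuous_on_restrict)
    then show ?thesis
      by (rule measurable_cong[THEN iffD1, rotated])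
        (use 2 sub rel_interior_subset[of F] in \<open>auto simp: space_restrict_space\<close>)
  qed
qed

section \<open>Averaging a convex function along the rays from the center\<close>

context circumscribed
begin

text \<open>The factor \<open>indicator W\<close> turns \<open>f\<close>, which is arbitrary outside
  \<open>W\<close>, into a bounded Borel function on the whole space, so every integrand is
  integrable under the finite measure \<open>\<mu>\<close>.\<close>

lemma convex_average_le:
  fixes f :: "'a \<Rightarrow> real"
  assumes W: "polytope W" and cW: "c \<in> interior W"
    and center: "(\<integral>x. \<phi> x \<partial>\<mu>) = measure \<mu> UNIV *\<^sub>R c"
    and f: "convex_on W f"
  shows "(\<integral>x. indicator W x * f x \<partial>\<mu>) \<le> (\<integral>x. indicator W (\<phi> x) * f (\<phi> x) \<partial>\<mu>)"
proof -
  interpret finite_measure \<mu> by (rule finite_measure_\<mu>)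
  define h where "h x = indicator W x * f x" for x
  have h[measurable]: "h \<in> borel_measurable borel"
    using convex_on_polytope_borel_measurable[OF W f] by (simp add: h_def[abs_def])
  obtain B where B: "\<And>x. x \<in> W \<Longrightarrow> \<bar>f x\<bar> \<le> B"
    using convex_on_polytope_bounded[OF W f cW] by blast
  have "B \<ge> 0" using B[of c] cW interior_subset by fastforce
  then have hB: "\<bar>h x\<bar> \<le> B" for x using B[of x] by (auto simp: h_def indicator_def)
  obtain a where a: "\<And>x. x \<in> W \<Longrightarrow> f c + a \<bullet> (x - c) \<le> f x"
    using convex_on_subgradient[OF f cW] by blast
  obtain R where R: "\<And>x. x \<in> W \<Longrightarrow> norm x \<le> R" using bddW by (auto simp: bounded_iff)
  obtain \<gamma> where \<gamma>: "0 \<le> \<gamma>" "\<gamma> \<le> 1" and gauge: "\<And>F :: 'a \<Rightarrow> real. F \<in> borel_measurable borel \<Longrightarrow>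
      (\<integral>x. g x * F (\<phi> x) \<partial>\<mu>) = \<gamma> * (\<integral>x. F (\<phi> x) \<partial>\<mu>)"
    using integral_gauge by blast
  have D: "x \<in> W" "\<phi> x \<in> W" "0 \<le> g x" "g x \<le> 1" if "x \<in> D" for x
    using that by (auto simp: D_def W_iff g_\<phi> less_imp_le[OF g_pos])
  have c: "c \<in> W" using cW interior_subset by blast
  let ?m = "measure \<mu> UNIV" and ?I = "\<integral>x. h (\<phi> x) \<partial>\<mu>"
  have ih: "integrable \<mu> h" and ih\<phi>: "integrable \<mu> (\<lambda>x. h (\<phi> x))"
    by (rule integrable_const_bound[of _ B]; simp add: hB)+
  have ig: "integrable \<mu> g"
    by (rule integrable_const_bound[of _ 1]) (use AE_\<mu> D in auto)
  have igh: "integrable \<mu> (\<lambda>x. g x * h (\<phi> x))"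
  proof (rule integrable_const_bound[of _ B])
    show "AE x in \<mu>. norm (g x * h (\<phi> x)) \<le> B"
      using AE_\<mu>
    proof eventually_elim
      case (elim x)
      have "\<bar>g x\<bar> * \<bar>h (\<phi> x)\<bar> \<le> 1 * B" using D[OF elim] hB by (intro mult_mono) auto
      then show ?case by (simp add: abs_mult)
    qed
  qed simp
  have i\<phi>: "integrable \<mu> \<phi>"
    by (rule integrable_const_bound[of _ R]) (use AE_\<mu> D R in auto)
  \<comment> \<open>Jensen's inequality: the affine minorant of \<open>f\<close> at \<open>c\<close>
    is integrated along \<open>\<phi>\<close>, and its linear part vanishes by
    \<open>center\<close>.\<close>
  have "f c * ?m \<le> ?I"
  proof -
    have "(\<integral>x. f c + a \<bullet> (\<phi> x - c) \<partial>\<mu>) \<le> ?I"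
    proof (rule integral_mono_AE)
      show "integrable \<mu> (\<lambda>x. f c + a \<bullet> (\<phi> x - c))" using i\<phi> by simp
      show "AE x in \<mu>. f c + a \<bullet> (\<phi> x - c) \<le> h (\<phi> x)"
        using AE_\<mu> by eventually_elim (use D a in \<open>auto simp: h_def\<close>)
    qed (rule ih\<phi>)
    also have "(\<integral>x. f c + a \<bullet> (\<phi> x - c) \<partial>\<mu>) = f c * ?m"
      using i\<phi> center by (simp add: mult.commute)
    finally show ?thesis .
  qed
  moreover have "(\<integral>x. h x \<partial>\<mu>) \<le> \<gamma> * ?I + (1 - \<gamma>) * (f c * ?m)"
  proof -
    have "(\<integral>x. h x \<partial>\<mu>) \<le> (\<integral>x. g x * h (\<phi> x) + (f c - f c * g x) \<partial>\<mu>)"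
    proof (rule integral_mono_AE)
      show "AE x in \<mu>. h x \<le> g x * h (\<phi> x) + (f c - f c * g x)"
        using AE_\<mu>
      proof eventually_elim
        case (elim x)
        have "g x \<noteq> 0" using elim g_pos[of x] by (auto simp: D_def)
        then have "x = (1 - g x) *\<^sub>R c + g x *\<^sub>R \<phi> x"
          by (simp add: \<phi>_def algebra_simps)
        then have "f x \<le> (1 - g x) * f c + g x * f (\<phi> x)"
          using convex_onD[OF f, of "g x" c "\<phi> x"] D[OF elim] c by simp
        then show ?case using D[OF elim] by (simp add: h_def algebra_simps)
      qed
    qed (use ih igh ig in auto)
    also have "\<dots> = (\<integral>x. g x * h (\<phi> x) \<partial>\<mu>) + (f c * ?m - f c * (\<integral>x. g x \<partial>\<mu>))"
      using igh ig by simp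
    \<comment> \<open>The constant function 1 identifies \<open>\<gamma>\<close> as the mean of
      \<open>g\<close>, so the weights of \<open>?I\<close> and \<open>f c * ?m\<close> add up to
      1.\<close>
    also have "(\<integral>x. g x \<partial>\<mu>) = \<gamma> * ?m" using gauge[of "\<lambda>_. 1"] by simp
    also have "(\<integral>x. g x * h (\<phi> x) \<partial>\<mu>) = \<gamma> * ?I" by (rule gauge[OF h])
    finally show ?thesis by (simp add: algebra_simps)
  qed
  moreover have "(1 - \<gamma>) * (f c * ?m) \<le> (1 - \<gamma>) * ?I"
    using calculation(1) \<gamma> by (intro mult_left_mono) auto
  ultimately show ?thesis by (simp add: h_def algebra_simps)
qed

end

theorem theorem2:
  fixes W :: "'a::euclidean_space set" and c :: 'a and r :: real
  assumes "polytope W"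
    and "interior W \<noteq> {}"
    and "inscribed_sphere c r W"
    and "c = boundary_center_of_mass W"
  shows "jensen_type W"
proof -
  have r: "r > 0" using assms(3) by (simp add: inscribed_sphere_def)
  obtain U where U: "finite U" "\<And>u. u \<in> U \<Longrightarrow> norm u = 1" and W: "W = {x. \<forall>u\<in>U. (x - c) \<bullet> u \<le> r}"
    using inscribed_sphere_halfspaces[OF assms(1-3)] by blast
  interpret circumscribed U c r W
    using U r W polytope_imp_bounded[OF assms(1)] by unfold_locales auto
  interpret finite_measure \<mu> by (rule finite_measure_\<mu>)
  have cW: "c \<in> interior W"
  proof -
    have "c \<in> W" using r by (simp add: W)
    moreover have "c \<notin> frontier W" by (simp add: frontier_W)
    ultimately show ?thesis using closure_subset by (auto simp: frontier_def)
  qed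
  \<comment> \<open>Passing from \<open>W\<close> to \<open>D\<close> removes only the null set
    consisting of \<open>c\<close>, so volume and integrals over \<open>W\<close> can be taken with
    respect to \<open>\<mu>\<close>.\<close>
  have AEc: "AE x in lborel. x \<noteq> c" by (rule AE_lborel_singleton)
  have null: "emeasure lborel W = emeasure lborel D"
    using AEc by (intro emeasure_eq_AE) (auto simp: D_def)
  have m: "measure lebesgue W = measure \<mu> UNIV"
    using null by (simp add: measure_completion) (simp add: measure_def emeasure_\<mu>)
  have mpos: "measure \<mu> UNIV > 0"
  proof -
    obtain e where e: "e > 0" "ball c e \<subseteq> W"
      using cW by (auto simp: mem_interior)
    have "0 < emeasure lborel (ball c e)"
      using e by (simp add: emeasure_ball unit_ball_vol_pos)
    also have "\<dots> \<le> emeasure lborel W" using e by (intro emeasure_mono) auto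
    also have "\<dots> = emeasure \<mu> UNIV" by (simp add: null emeasure_\<mu>)
    finally show ?thesis by (simp add: emeasure_eq_measure)
  qed
  have "c = (1 / measure \<mu> UNIV) *\<^sub>R (\<integral>x. \<phi> x \<partial>\<mu>)"
    using assms(4) average_frontier[of "\<lambda>x. x"] by (simp add: boundary_center_of_mass_def)
  then have center: "(\<integral>x. \<phi> x \<partial>\<mu>) = measure \<mu> UNIV *\<^sub>R c"
    using mpos by (metis (no_types) divide_self_if less_irrefl scaleR_one scaleR_scaleR times_divide_eq_right mult.right_neutral)
  have "(1 / measure lebesgue W) * (LINT x:W|lebesgue. f x)
          \<le> (1 / measure surface_measure (frontier W)) * (LINT x:frontier W|surface_measure. f x)"
    if f: "convex_on W f" for f :: "'a \<Rightarrow> real"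
  proof -
    define h where "h x = indicator W x * f x" for x
    have h[measurable]: "h \<in> borel_measurable borel"
      using convex_on_polytope_borel_measurable[OF assms(1) f] by (simp add: h_def[abs_def])
    have "(LINT x:W|lebesgue. f x) = (\<integral>x. h x \<partial>lborel)"
      unfolding set_lebesgue_integral_def by (simp add: h_def[symmetric] integral_completion)
    also have "\<dots> = (\<integral>x. indicator D x * h x \<partial>lborel)"
    proof (rule integral_cong_AE)
      show "AE x in lborel. h x = indicator D x * h x"
        using AEc by eventually_elim (auto simp: h_def D_def indicator_def)
    qed auto
    also have "\<dots> = (\<integral>x. h x \<partial>\<mu>)"
    proof -
      have "\<mu> = density lborel (\<lambda>x. ennreal (indicator D x))"
        by (simp add: \<mu>_def ennreal_indicator)
      then show ?thesis by (simp add: integral_density)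
    qed
    also have "\<dots> \<le> (\<integral>x. h (\<phi> x) \<partial>\<mu>)"
      unfolding h_def by (rule convex_average_le[OF assms(1) cW center f])
    finally have "(1 / measure lebesgue W) * (LINT x:W|lebesgue. f x)
        \<le> (1 / measure \<mu> UNIV) *\<^sub>R (\<integral>x. h (\<phi> x) \<partial>\<mu>)"
      using mpos by (simp add: m divide_right_mono)
    also have "\<dots> = (1 / measure surface_measure (frontier W)) *\<^sub>R (LINT x:frontier W|surface_measure. h x)"
      by (rule average_frontier[symmetric]) simp
    also have "(LINT x:frontier W|surface_measure. h x) = (LINT x:frontier W|surface_measure. f x)"
      by (intro set_lebesgue_integral_cong) (auto simp: h_def frontier_W W_iff)
    finally show ?thesis by simp
  qed
  then show ?thesis
    using polytope_imp_convex[OF assms(1)] polytope_imp_closed[OF assms(1)]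
    by (simp add: jensen_type_def)
qed

end
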